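(* If $n\ge 2$ and $k\ge 1$, then $\mathrm{H}_2(\mathcal{K}^{\mathrm{IA}}_{n,k};\mathbb{Q})$ is infinite dimensional. Consequently, $\mathcal{K}^{\mathrm{IA}}_{n,k}$ is not finitely presentable.
   Context: $F_{n,k}$ is the free group on $\{x_1,\dots,x_n,y_1,\dots,y_k\}$ and $F_n$ is the free group on $\{x_1,\dots,x_n\}$. Write $[\![z]\!]$ for the conjugacy class of $z\in F_{n,k}$. Define $$\mathcal{A}_{n,k}=\{f\in\mathrm{Aut}(F_{n,k}) \mid [\![f(y_i)]\!]=[\![y_i]\!] \text{ for } 1\le i\le k\}.$$ The map $F_{n,k}\to F_n$ whose kernel is the normal closure of $\{y_1,\dots,y_k\}$ (sending $x_i\mapsto x_i$) induces a homomorphism $\pi:\mathcal{A}_{n,k}\to\mathrm{Aut}(F_n)$; put $\mathcal{K}_{n,k}=\ker\pi$. Let $\mathrm{IA}_{n,k}$ be the kernel of the natural map $\mathrm{Aut}(F_{n,k})\to\mathrm{GL}_{n+k}(\mathbb{Z})$ given by the action on the abelianization of $F_{n,k}$, and put $\mathcal{K}^{\mathrm{IA}}_{n,k}=\mathcal{K}_{n,k}\cap\mathrm{IA}_{n,k}$. $\mathrm{H}_2(G;\mathbb{Q})$ denotes group homology with trivial coefficients. *)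

theory Defs
  imports "Jordan_Normal_Form.VS_Connect" "HOL-Algebra.Bij" "HOL-Algebra.Generated_Groups"
    "HOL-Algebra.AbelCoset" "HOL-Algebra.Free_Abelian_Groups"
begin

hide_const (open) Multiset.mult Polynomial.smult Modules.module

section \<open>Free groups\<close>

text \<open>A letter \<open>(a, True)\<close> stands for the generator \<open>a\<close> and \<open>(a, False)\<close> for its inverse.\<close>

type_synonym 'a word = "('a \<times> bool) list"

definition inv_letter :: "'a \<times> bool \<Rightarrow> 'a \<times> bool" where
  "inv_letter x = (fst x, \<not> snd x)"

definition reduced :: "'a word \<Rightarrow> bool" where
  "reduced = successively (\<lambda>x y. y \<noteq> inv_letter x)"

definition cancel_cons :: "'a \<times> bool \<Rightarrow> 'a word \<Rightarrow> 'a word" where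
  "cancel_cons x w = (if w \<noteq> [] \<and> hd w = inv_letter x then tl w else x # w)"

text \<open>For reduced \<open>u\<close> and \<open>v\<close>, \<open>foldr cancel_cons u v\<close> is the reduced form of \<open>u @ v\<close>.\<close>

definition free_group :: "'a set \<Rightarrow> 'a word monoid" where
  "free_group S =
     \<lparr>carrier = {w. reduced w \<and> fst ` set w \<subseteq> S}, mult = foldr cancel_cons, one = []\<rparr>"

definition gen :: "'a \<Rightarrow> 'a word" where
  "gen a = [(a, True)]"

definition free_lift :: "('b, 'c) monoid_scheme \<Rightarrow> ('a \<Rightarrow> 'b) \<Rightarrow> 'a word \<Rightarrow> 'b" where
  "free_lift G f w =
     foldr (\<lambda>x z. (if snd x then f (fst x) else inv\<^bsub>G\<^esub> f (fst x)) \<otimes>\<^bsub>G\<^esub> z) w \<one>\<^bsub>G\<^esub>"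

lemma inv_letter_simps [simp]:
  "inv_letter (inv_letter x) = x" "fst (inv_letter x) = fst x" "inv_letter x \<noteq> x"
  "x \<noteq> inv_letter x"
  by (auto simp: inv_letter_def prod_eq_iff)

lemma reduced_Nil [simp]: "reduced []"
  by (simp add: reduced_def)

lemma reduced_Cons: "reduced (x # w) \<longleftrightarrow> reduced w \<and> (w = [] \<or> hd w \<noteq> inv_letter x)"
  by (cases w) (auto simp: reduced_def)

lemma reduced_cancel_cons: "reduced w \<Longrightarrow> reduced (cancel_cons x w)"
  by (cases w) (auto simp: cancel_cons_def reduced_Cons)

lemma cancel_cons_eq_Cons: "reduced (x # w) \<Longrightarrow> cancel_cons x w = x # w"
  by (auto simp: cancel_cons_def reduced_Cons)

lemma cancel_cons_inverse:
  assumes "reduced w"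
  shows "cancel_cons x (cancel_cons (inv_letter x) w) = w"
  using assms by (cases w) (auto simp: cancel_cons_def reduced_Cons)

lemma reduced_foldr: "reduced v \<Longrightarrow> reduced (foldr cancel_cons u v)"
  by (induction u) (auto intro: reduced_cancel_cons)

lemma set_cancel_cons: "set (cancel_cons x w) \<subseteq> insert x (set w)"
  by (cases w) (auto simp: cancel_cons_def)

lemma set_foldr: "set (foldr cancel_cons u v) \<subseteq> set u \<union> set v"
  by (induction u) (use set_cancel_cons in \<open>force+\<close>)

lemma foldr_cancel_cons:
  assumes "reduced w"
  shows "foldr cancel_cons (cancel_cons x v) w = cancel_cons x (foldr cancel_cons v w)"
proof (cases "v \<noteq> [] \<and> hd v = inv_letter x")
  case True
  then obtain v' where v: "v = inv_letter x # v'"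
    by (cases v) auto
  show ?thesis
    unfolding v using cancel_cons_inverse[OF reduced_foldr[OF assms]]
    by (simp add: cancel_cons_def)
qed (auto simp: cancel_cons_def)

lemma foldr_cancel_cons_assoc:
  "reduced w \<Longrightarrow>
    foldr cancel_cons (foldr cancel_cons u v) w = foldr cancel_cons u (foldr cancel_cons v w)"
  by (induction u) (auto simp: foldr_cancel_cons)

lemma foldr_cancel_cons_Nil: "reduced u \<Longrightarrow> foldr cancel_cons u [] = u"
  by (induction u) (auto simp: reduced_Cons cancel_cons_eq_Cons)

lemma foldr_cancel_cons_inverse:
  "reduced v \<Longrightarrow> foldr cancel_cons (rev (map inv_letter u)) (foldr cancel_cons u v) = v"
proof (induction u)
  case (Cons x u)
  then show ?case
    using cancel_cons_inverse[of "foldr cancel_cons u v" "inv_letter x"]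
    by (simp add: reduced_foldr)
qed simp

lemma carrier_free_group: "w \<in> carrier (free_group S) \<longleftrightarrow> reduced w \<and> fst ` set w \<subseteq> S"
  by (simp add: free_group_def)

lemma free_group_simps: "mult (free_group S) = foldr cancel_cons" "one (free_group S) = []"
  by (simp_all add: free_group_def)

lemma free_group_mult_closed:
  assumes "u \<in> carrier (free_group S)" "v \<in> carrier (free_group S)"
  shows "foldr cancel_cons u v \<in> carrier (free_group S)"
  using assms set_foldr[of u v] unfolding carrier_free_group
  by (auto simp: reduced_foldr) (metis UnE fst_conv image_subset_iff subsetD)

lemma group_free_group: "group (free_group S)"
proof (rule groupI)
  fix u v w
  assume *: "u \<in> carrier (free_group S)" "v \<in> carrier (free_group S)" "w \<in> carrier (free_group S)"
  then show "u \<otimes>\<^bsub>free_group S\<^esub> v \<otimes>\<^bsub>free_group S\<^esub> w =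
      u \<otimes>\<^bsub>free_group S\<^esub> (v \<otimes>\<^bsub>free_group S\<^esub> w)"
    by (simp add: free_group_simps carrier_free_group foldr_cancel_cons_assoc)
next
  fix u assume u: "u \<in> carrier (free_group S)"
  define v where "v = foldr cancel_cons (rev (map inv_letter u)) []"
  have "set v \<subseteq> inv_letter ` set u"
    using set_foldr[of "rev (map inv_letter u)" "[]"] by (simp add: v_def)
  then have "fst ` set v \<subseteq> fst ` inv_letter ` set u"
    by (rule image_mono)
  then have "fst ` set v \<subseteq> fst ` set u"
    by (simp add: image_image)
  then have "v \<in> carrier (free_group S)"
    using u by (auto simp: carrier_free_group v_def reduced_foldr)
  moreover have "foldr cancel_cons v u = []"
    using u foldr_cancel_cons_inverse[of "[]" u]
    by (simp add: v_def carrier_free_group foldr_cancel_cons_assoc foldr_cancel_cons_Nil)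
  ultimately show "\<exists>v\<in>carrier (free_group S). v \<otimes>\<^bsub>free_group S\<^esub> u = \<one>\<^bsub>free_group S\<^esub>"
    by (auto simp: free_group_simps)
qed (auto simp: free_group_simps carrier_free_group[of "[]"] intro: free_group_mult_closed)

lemma gen_in_free_group [simp]: "gen a \<in> carrier (free_group S) \<longleftrightarrow> a \<in> S"
  by (simp add: carrier_free_group gen_def reduced_Cons)

lemma inv_gen:
  assumes "a \<in> S"
  shows "inv\<^bsub>free_group S\<^esub> (gen a) = [(a, False)]"
  by (rule group.inv_equality[OF group_free_group])
    (use assms in \<open>auto simp: free_group_simps gen_def cancel_cons_def inv_letter_def
       carrier_free_group reduced_Cons\<close>)

lemma free_group_induct [consumes 1, case_names one gen inv]:
  assumes w: "w \<in> carrier (free_group S)"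
    and "P \<one>\<^bsub>free_group S\<^esub>"
    and "\<And>a w. a \<in> S \<Longrightarrow> w \<in> carrier (free_group S) \<Longrightarrow> P w \<Longrightarrow> P (gen a \<otimes>\<^bsub>free_group S\<^esub> w)"
    and "\<And>a w. a \<in> S \<Longrightarrow> w \<in> carrier (free_group S) \<Longrightarrow> P w \<Longrightarrow>
           P (inv\<^bsub>free_group S\<^esub> gen a \<otimes>\<^bsub>free_group S\<^esub> w)"
  shows "P w"
  using w
proof (induction w)
  case Nil
  then show ?case using assms(2) by (simp add: free_group_simps)
next
  case (Cons x w)
  obtain a e where x: "x = (a, e)" by force
  have *: "a \<in> S" "w \<in> carrier (free_group S)" "cancel_cons x w = x # w"
    using Cons.prems by (auto simp: x carrier_free_group reduced_Cons cancel_cons_eq_Cons)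
  show ?case
  proof (cases e)
    case True
    then show ?thesis
      using assms(3)[OF *(1,2) Cons.IH[OF *(2)]] *(3) by (simp add: x gen_def free_group_simps)
  next
    case False
    then show ?thesis
      using assms(4)[OF *(1,2) Cons.IH[OF *(2)]] *(1,3) by (simp add: x inv_gen free_group_simps)
  qed
qed

lemma free_group_hom_eqI:
  assumes "group G" "f \<in> hom (free_group S) G" "g \<in> hom (free_group S) G"
    and eq: "\<And>a. a \<in> S \<Longrightarrow> f (gen a) = g (gen a)"
    and w: "w \<in> carrier (free_group S)"
  shows "f w = g w"
proof -
  interpret F: group "free_group S" by (rule group_free_group)
  interpret f: group_hom "free_group S" G f
    using assms by (simp add: group_hom_def group_hom_axioms_def group_free_group)
  interpret g: group_hom "free_group S" G g
    using assms by (simp add: group_hom_def group_hom_axioms_def group_free_group)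
  show ?thesis
    using w by (induction w rule: free_group_induct) (auto simp: eq)
qed

context
  fixes G (structure) and f S
  assumes G: "group G" and f: "f \<in> S \<rightarrow> carrier G"
begin

interpretation group G by (rule G)

lemma free_lift_closed: "fst ` set w \<subseteq> S \<Longrightarrow> free_lift G f w \<in> carrier G"
  using f by (induction w) (auto simp: free_lift_def)

lemma free_lift_cancel_cons:
  assumes "fst x \<in> S" "fst ` set w \<subseteq> S"
  shows "free_lift G f (cancel_cons x w) = (if snd x then f (fst x) else inv f (fst x)) \<otimes> free_lift G f w"
proof (cases "w \<noteq> [] \<and> hd w = inv_letter x")
  case True
  then obtain v where w: "w = inv_letter x # v"
    by (cases w) auto
  have "free_lift G f v \<in> carrier G" "f (fst x) \<in> carrier G"
    using assms f by (auto simp: w intro!: free_lift_closed)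
  then show ?thesis
    by (auto simp: w cancel_cons_def free_lift_def inv_letter_def m_assoc[symmetric])
qed (auto simp: free_lift_def cancel_cons_def)

lemma free_lift_hom: "free_lift G f \<in> hom (free_group S) G"
proof (rule homI)
  fix u v assume uv: "u \<in> carrier (free_group S)" "v \<in> carrier (free_group S)"
  from uv(1) have "fst ` set u \<subseteq> S" by (simp add: carrier_free_group)
  then show "free_lift G f (u \<otimes>\<^bsub>free_group S\<^esub> v) = free_lift G f u \<otimes> free_lift G f v"
  proof (induction u)
    case Nil
    then show ?case
      using free_lift_closed[of v] uv(2)
      by (simp add: free_lift_def[of _ _ "[]"] free_group_simps carrier_free_group)
  next
    case (Cons x u)
    have "fst ` set (foldr cancel_cons u v) \<subseteq> S"
      using uv(2) Cons.prems set_foldr[of u v] by (force simp: carrier_free_group)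
    moreover have "free_lift G f (x # u) = (if snd x then f (fst x) else inv f (fst x)) \<otimes> free_lift G f u"
      by (simp add: free_lift_def)
    moreover have "free_lift G f u \<in> carrier G" "free_lift G f v \<in> carrier G"
      "f (fst x) \<in> carrier G"
      using Cons.prems uv(2) f by (auto intro!: free_lift_closed simp: carrier_free_group)
    ultimately show ?case
      using Cons by (auto simp: free_group_simps free_lift_cancel_cons m_assoc)
  qed
qed (simp add: carrier_free_group free_lift_closed)

lemma free_lift_gen: "a \<in> S \<Longrightarrow> free_lift G f (gen a) = f a"
  using f by (simp add: free_lift_def gen_def Pi_iff)

end

lemma free_lift_group_hom:
  "group G \<Longrightarrow> f \<in> S \<rightarrow> carrier G \<Longrightarrow> group_hom (free_group S) G (free_lift G f)"
  by (simp add: group_hom_def group_hom_axioms_def group_free_group free_lift_hom)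


section \<open>Finite presentability\<close>

definition normal_closure :: "('a, 'b) monoid_scheme \<Rightarrow> 'a set \<Rightarrow> 'a set" where
  "normal_closure G R = (\<lambda>N. N \<lhd> G) hull R"

definition presented_group :: "'a set \<Rightarrow> 'a word set \<Rightarrow> 'a word set monoid" where
  "presented_group S R = free_group S Mod normal_closure (free_group S) R"

definition finitely_presentable :: "('a, 'b) monoid_scheme \<Rightarrow> bool" where
  "finitely_presentable G \<longleftrightarrow>
     (\<exists>(m::nat) R. finite R \<and> R \<subseteq> carrier (free_group {..<m}) \<and>
        G \<cong> presented_group {..<m} R)"

lemma (in group) normal_closure_normal:
  assumes "R \<subseteq> carrier G"
  shows "normal_closure G R \<lhd> G"
proof -
  let ?\<N> = "{N. N \<lhd> G \<and> R \<subseteq> N}"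
  have sub: "subgroup N G" if "N \<in> ?\<N>" for N
    using that by (auto simp: normal_imp_subgroup)
  have "carrier G \<in> ?\<N>"
    using assms by (auto simp: normal_inv_iff subgroup_self)
  then have "subgroup (\<Inter>?\<N>) G"
    by (intro subgroups_Inter) (use sub in auto)
  then show ?thesis
    unfolding normal_closure_def hull_def by (auto simp: normal_inv_iff)
qed


section \<open>Group homology with rational coefficients\<close>

text \<open>
  The unnormalized inhomogeneous bar complex of \<open>G\<close> with trivial coefficients \<open>\<rat>\<close>: in degree
  \<open>n\<close> it is the \<open>\<rat>\<close>-vector space with basis the \<open>n\<close>-tuples of elements of \<open>G\<close>. The multiplicative
  fields of the module records are not used.
\<close>

definition bar_chains ::
    "('a, 'b) monoid_scheme \<Rightarrow> nat \<Rightarrow> (rat, 'a list \<Rightarrow>\<^sub>0 rat) module" where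
  "bar_chains G n =
     \<lparr>carrier = {c. Poly_Mapping.keys c \<subseteq> {gs. length gs = n \<and> set gs \<subseteq> carrier G}},
      mult = (\<lambda>_ _. 0), one = 0, ring.zero = 0, add = (+), smult = (\<lambda>r. Poly_Mapping.map ((*) r))\<rparr>"

text \<open>
  The faces of \<open>[g\<^sub>1, \<dots>, g\<^sub>n]\<close> are \<open>[g\<^sub>2, \<dots>, g\<^sub>n]\<close>,
  \<open>[g\<^sub>1, \<dots>, g\<^sub>i g\<^sub>i\<^sub>+\<^sub>1, \<dots>, g\<^sub>n]\<close> for \<open>0 < i < n\<close>, and \<open>[g\<^sub>1, \<dots>, g\<^sub>n\<^sub>-\<^sub>1]\<close>.
\<close>

definition bar_face :: "('a, 'b) monoid_scheme \<Rightarrow> nat \<Rightarrow> 'a list \<Rightarrow> 'a list" where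
  "bar_face G i gs =
     (if i = 0 then tl gs
      else if i = length gs then butlast gs
      else take (i - 1) gs @ [gs ! (i - 1) \<otimes>\<^bsub>G\<^esub> gs ! i] @ drop (i + 1) gs)"

definition bar_boundary ::
    "('a, 'b) monoid_scheme \<Rightarrow> nat \<Rightarrow> ('a list \<Rightarrow>\<^sub>0 rat) \<Rightarrow> ('a list \<Rightarrow>\<^sub>0 rat)" where
  "bar_boundary G n c =
     (if n = 0 then 0
      else \<Sum>gs\<in>Poly_Mapping.keys c. \<Sum>i\<le>n.
             Poly_Mapping.single (bar_face G i gs) ((- 1) ^ i * Poly_Mapping.lookup c gs))"

definition bar_cycles :: "('a, 'b) monoid_scheme \<Rightarrow> nat \<Rightarrow> ('a list \<Rightarrow>\<^sub>0 rat) set" where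
  "bar_cycles G n = {c \<in> carrier (bar_chains G n). bar_boundary G n c = 0}"

definition bar_boundaries :: "('a, 'b) monoid_scheme \<Rightarrow> nat \<Rightarrow> ('a list \<Rightarrow>\<^sub>0 rat) set" where
  "bar_boundaries G n = bar_boundary G (Suc n) ` carrier (bar_chains G (Suc n))"

definition quotient_module :: "('r, 'm, 'c) module_scheme \<Rightarrow> 'm set \<Rightarrow> ('r, 'm set) module" where
  "quotient_module M N =
     \<lparr>carrier = a_rcosets\<^bsub>M\<^esub> N, mult = (\<lambda>_ _. N), one = N, ring.zero = N, add = set_add M,
      smult = (\<lambda>r C. \<Union>v\<in>C. N +>\<^bsub>M\<^esub> (r \<odot>\<^bsub>M\<^esub> v))\<rparr>"

definition group_homology ::
    "('a, 'b) monoid_scheme \<Rightarrow> nat \<Rightarrow> (rat, ('a list \<Rightarrow>\<^sub>0 rat) set) module" where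
  "group_homology G n =
     quotient_module (bar_chains G n\<lparr>carrier := bar_cycles G n\<rparr>) (bar_boundaries G n)"

lemma lookup_smult_bar_chains:
  "Poly_Mapping.lookup (r \<odot>\<^bsub>bar_chains G n\<^esub> c) gs = r * Poly_Mapping.lookup c gs"
  by (simp add: bar_chains_def map.rep_eq when_def)

lemma keys_smult_bar_chains:
  "Poly_Mapping.keys (r \<odot>\<^bsub>bar_chains G n\<^esub> c) \<subseteq> Poly_Mapping.keys c"
  by (auto simp: in_keys_iff lookup_smult_bar_chains)

lemma bar_chains_simps:
  "c \<in> carrier (bar_chains G n) \<longleftrightarrow>
     (\<forall>gs\<in>Poly_Mapping.keys c. length gs = n \<and> set gs \<subseteq> carrier G)"
  "\<zero>\<^bsub>bar_chains G n\<^esub> = 0"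
  "add (bar_chains G n) = (+)"
  by (auto simp: bar_chains_def)

lemma module_bar_chains: "Module.module class_ring (bar_chains G n)"
proof (rule moduleI)
  show "cring (class_ring :: rat ring)"
    by (rule class_cring.cring_axioms)
  show "abelian_group (bar_chains G n)"
  proof (rule abelian_groupI)
    fix c assume c: "c \<in> carrier (bar_chains G n)"
    then have "- c \<in> carrier (bar_chains G n)"
      by (simp add: bar_chains_simps)
    then show "\<exists>d\<in>carrier (bar_chains G n). d \<oplus>\<^bsub>bar_chains G n\<^esub> c = \<zero>\<^bsub>bar_chains G n\<^esub>"
      by (intro bexI[of _ "- c"]) (simp_all add: bar_chains_simps)
  next
    fix c d assume "c \<in> carrier (bar_chains G n)" "d \<in> carrier (bar_chains G n)"
    then show "c \<oplus>\<^bsub>bar_chains G n\<^esub> d \<in> carrier (bar_chains G n)"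
      using keys_add[of c d] unfolding bar_chains_simps by blast
  qed (simp_all add: bar_chains_simps add_ac)
next
  fix r c assume "c \<in> carrier (bar_chains G n)"
  then show "r \<odot>\<^bsub>bar_chains G n\<^esub> c \<in> carrier (bar_chains G n)"
    unfolding bar_chains_simps(1) using keys_smult_bar_chains by blast
qed (auto intro!: poly_mapping_eqI
       simp: lookup_smult_bar_chains lookup_add bar_chains_simps algebra_simps)

lemma bar_boundary_superset:
  assumes "finite A" "Poly_Mapping.keys c \<subseteq> A" "n > 0"
  shows "bar_boundary G n c = (\<Sum>gs\<in>A. \<Sum>i\<le>n.
    Poly_Mapping.single (bar_face G i gs) ((- 1) ^ i * Poly_Mapping.lookup c gs))"
  unfolding bar_boundary_def
  using assms by (auto intro!: sum.mono_neutral_left simp: in_keys_iff)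

lemma bar_boundary_add: "bar_boundary G n (c + d) = bar_boundary G n c + bar_boundary G n d"
proof (cases "n = 0")
  case False
  let ?A = "Poly_Mapping.keys c \<union> Poly_Mapping.keys d"
  have *: "bar_boundary G n e = (\<Sum>gs\<in>?A. \<Sum>i\<le>n.
      Poly_Mapping.single (bar_face G i gs) ((- 1) ^ i * Poly_Mapping.lookup e gs))"
    if "Poly_Mapping.keys e \<subseteq> ?A" for e
    using that False by (intro bar_boundary_superset) auto
  show ?thesis
    using keys_add[of c d]
    by (simp add: * lookup_add single_add ring_distribs sum.distrib)
qed (simp add: bar_boundary_def)

lemma bar_boundary_sum: "bar_boundary G n (sum f A) = (\<Sum>a\<in>A. bar_boundary G n (f a))"
proof -
  have "bar_boundary G n 0 = 0"
    by (simp add: bar_boundary_def)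
  then show ?thesis
    by (induction A rule: infinite_finite_induct) (simp_all add: bar_boundary_add)
qed

lemma bar_boundary_smult:
  "bar_boundary G n (r \<odot>\<^bsub>bar_chains G m\<^esub> c) = r \<odot>\<^bsub>bar_chains G l\<^esub> bar_boundary G n c"
proof (cases "n = 0")
  case True
  then show ?thesis
    by (auto intro!: poly_mapping_eqI simp: bar_boundary_def lookup_smult_bar_chains)
next
  case False
  have "bar_boundary G n (r \<odot>\<^bsub>bar_chains G m\<^esub> c) = (\<Sum>gs\<in>Poly_Mapping.keys c. \<Sum>i\<le>n.
      Poly_Mapping.single (bar_face G i gs)
        ((- 1) ^ i * Poly_Mapping.lookup (r \<odot>\<^bsub>bar_chains G m\<^esub> c) gs))"
    using False keys_smult_bar_chains[where r = r and c = c and n = m and G = G] by (intro bar_boundary_superset) auto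
  then show ?thesis
    using False
    by (auto intro!: poly_mapping_eqI sum.cong
        simp: bar_boundary_def lookup_smult_bar_chains lookup_sum lookup_single sum_distrib_left
          when_def)
qed

lemma bar_boundary_single:
  "n > 0 \<Longrightarrow> bar_boundary G n (Poly_Mapping.single gs r) =
    (\<Sum>i\<le>n. Poly_Mapping.single (bar_face G i gs) ((- 1) ^ i * r))"
  by (subst bar_boundary_superset[of "{gs}"]) auto

lemma length_bar_face: "length gs = Suc n \<Longrightarrow> i \<le> Suc n \<Longrightarrow> length (bar_face G i gs) = n"
  by (auto simp: bar_face_def)

lemma nth_bar_face:
  assumes "length gs = Suc n" "i \<le> Suc n" "j < n"
  shows "bar_face G i gs ! j =
    (if Suc j < i then gs ! j else if Suc j = i then gs ! j \<otimes>\<^bsub>G\<^esub> gs ! Suc j else gs ! Suc j)"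
  using assms by (auto simp: bar_face_def nth_tl nth_butlast nth_append min_def nth_Cons')

lemma (in group) set_bar_face:
  assumes "set gs \<subseteq> carrier G" "length gs = Suc n" "i \<le> Suc n"
  shows "set (bar_face G i gs) \<subseteq> carrier G"
proof
  fix x assume "x \<in> set (bar_face G i gs)"
  then obtain j where j: "j < n" "x = bar_face G i gs ! j"
    using assms by (metis in_set_conv_nth length_bar_face)
  moreover have "gs ! j \<in> carrier G" "gs ! Suc j \<in> carrier G"
    using j assms(1,2) nth_mem[of j gs] nth_mem[of "Suc j" gs] by auto
  ultimately show "x \<in> carrier G"
    using assms by (cases "Suc j = i") (auto simp: nth_bar_face)
qed

lemma (in group) bar_face_bar_face:
  assumes "set gs \<subseteq> carrier G" "length gs = Suc (Suc n)" "i < j" "j \<le> Suc (Suc n)"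
  shows "bar_face G i (bar_face G j gs) = bar_face G (j - 1) (bar_face G i gs)"
proof (rule nth_equalityI)
  show len: "length (bar_face G i (bar_face G j gs)) = length (bar_face G (j - 1) (bar_face G i gs))"
    using assms by (simp add: length_bar_face)
  fix m assume "m < length (bar_face G i (bar_face G j gs))"
  then have m: "m < n"
    using assms by (simp add: length_bar_face)
  have "gs ! l \<in> carrier G" if "l < Suc (Suc n)" for l
    using that assms(1,2) nth_mem[of l gs] by auto
  then have "gs ! m \<in> carrier G" "gs ! Suc m \<in> carrier G" "gs ! Suc (Suc m) \<in> carrier G"
    using m by simp_all
  then show "bar_face G i (bar_face G j gs) ! m = bar_face G (j - 1) (bar_face G i gs) ! m"
    using m assms
    by (auto simp: nth_bar_face[of _ n] nth_bar_face[of _ "Suc n"] length_bar_face m_assoc)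
qed

lemma (in group) bar_boundary_bar_boundary_single:
  assumes gs: "set gs \<subseteq> carrier G" "length gs = Suc n"
  shows "bar_boundary G n (bar_boundary G (Suc n) (Poly_Mapping.single gs r)) = 0"
proof (cases n)
  case 0
  then show ?thesis by (simp add: bar_boundary_def)
next
  case (Suc m)
  define f where "f = (\<lambda>(i, j). Poly_Mapping.single (bar_face G i (bar_face G j gs)) ((- 1) ^ (i + j) * r))"
  define A where "A = {(i, j). i < j \<and> j \<le> Suc n}"
  define B where "B = {(i, j). j \<le> i \<and> i \<le> n}"
  have fin: "finite A" "finite B"
    by (rule finite_subset[of _ "{..Suc n} \<times> {..Suc n}"]; force simp: A_def B_def)+
  have "bar_boundary G n (bar_boundary G (Suc n) (Poly_Mapping.single gs r)) =
      (\<Sum>j\<le>Suc n. \<Sum>i\<le>n. f (i, j))"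
    using Suc by (simp add: bar_boundary_single bar_boundary_sum f_def power_add mult.assoc
        del: sum.atMost_Suc)
  also have "\<dots> = sum f ({..n} \<times> {..Suc n})"
    by (subst sum.swap) (simp add: sum.cartesian_product del: sum.atMost_Suc)
  also have "{..n} \<times> {..Suc n} = A \<union> B"
    by (auto simp: A_def B_def)
  also have "sum f (A \<union> B) = sum f A + sum f B"
    by (rule sum.union_disjoint[OF fin]) (auto simp: A_def B_def)
  also have "sum f A = (\<Sum>p\<in>B. - f p)"
  proof (rule sum.reindex_bij_witness[of _ "\<lambda>(i, j). (j, Suc i)" "\<lambda>(i, j). (j - 1, i)"])
    fix p assume p: "p \<in> A"
    then obtain i j where ij: "p = (i, Suc j)" "i \<le> j" "j \<le> n"
      by (cases p; cases "snd p") (auto simp: A_def)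
    then show "- f (case p of (i, j) \<Rightarrow> (j - 1, i)) = f p"
      using bar_face_bar_face[of gs m i "Suc j"] gs Suc
      by (simp add: f_def single_uminus[symmetric] add.commute)
  qed (auto simp: A_def B_def)
  finally show ?thesis
    by (simp add: sum_negf)
qed

lemma bar_chain_eq_sum:
  "c = (\<Sum>gs\<in>Poly_Mapping.keys c. Poly_Mapping.single gs (Poly_Mapping.lookup c gs))"
  by (rule poly_mapping_eqI)
    (simp add: lookup_sum lookup_single when_def in_keys_iff)

lemma (in group) bar_boundary_bar_boundary:
  assumes "c \<in> carrier (bar_chains G (Suc n))"
  shows "bar_boundary G n (bar_boundary G (Suc n) c) = 0"
proof -
  have "bar_boundary G n (bar_boundary G (Suc n) c) =
      bar_boundary G n (bar_boundary G (Suc n)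
        (\<Sum>gs\<in>Poly_Mapping.keys c. Poly_Mapping.single gs (Poly_Mapping.lookup c gs)))"
    by (subst bar_chain_eq_sum[of c]) (rule refl)
  also have "\<dots> = 0"
    unfolding bar_boundary_sum
    using assms by (intro sum.neutral ballI bar_boundary_bar_boundary_single)
      (auto simp: bar_chains_simps)
  finally show ?thesis .
qed

lemma (in group) bar_boundary_closed:
  assumes "c \<in> carrier (bar_chains G (Suc n))"
  shows "bar_boundary G (Suc n) c \<in> carrier (bar_chains G n)"
proof -
  have "Poly_Mapping.keys (bar_boundary G (Suc n) c) \<subseteq>
      (\<Union>gs\<in>Poly_Mapping.keys c. \<Union>i\<le>Suc n. {bar_face G i gs})"
    unfolding bar_boundary_def using keys_single
    by (simp del: sum.atMost_Suc)
      (intro order_trans[OF keys_sum] UN_mono subset_refl; auto split: if_splits)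
  then show ?thesis
    using assms set_bar_face length_bar_face
    unfolding bar_chains_simps by blast
qed

lemma submodule_bar_cycles: "LinearCombinations.submodule class_ring (bar_cycles G n) (bar_chains G n)"
proof -
  interpret Module.module class_ring "bar_chains G n" by (rule module_bar_chains)
  have smult: "r \<odot>\<^bsub>bar_chains G n\<^esub> 0 = 0" for r :: rat
    by (auto intro!: poly_mapping_eqI simp: lookup_smult_bar_chains)
  show ?thesis
  proof (rule LinearCombinations.submodule.intro)
    fix c d assume cd: "c \<in> bar_cycles G n" "d \<in> bar_cycles G n"
    then show "c \<oplus>\<^bsub>bar_chains G n\<^esub> d \<in> bar_cycles G n"
      using a_closed[of c d] by (simp add: bar_cycles_def bar_boundary_add bar_chains_simps(3))
  next
    fix r :: rat and c assume "r \<in> carrier class_ring" "c \<in> bar_cycles G n"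
    then show "r \<odot>\<^bsub>bar_chains G n\<^esub> c \<in> bar_cycles G n"
      using smult_closed[of r c] smult
      by (simp add: bar_cycles_def bar_boundary_smult[where l = n])
  qed (auto simp: bar_cycles_def bar_chains_simps bar_boundary_def module_bar_chains)
qed

lemma module_bar_cycles:
  "Module.module class_ring (bar_chains G n\<lparr>carrier := bar_cycles G n\<rparr>)"
  by (rule module.submodule_is_module[OF module_bar_chains submodule_bar_cycles])

lemma (in group) submodule_bar_boundaries:
  "LinearCombinations.submodule class_ring (bar_boundaries G n)
     (bar_chains G n\<lparr>carrier := bar_cycles G n\<rparr>)"
proof (rule LinearCombinations.submodule.intro)
  interpret Suc: Module.module class_ring "bar_chains G (Suc n)" by (rule module_bar_chains)
  show "Module.module class_ring (bar_chains G n\<lparr>carrier := bar_cycles G n\<rparr>)"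
    by (rule module_bar_cycles)
  show "bar_boundaries G n \<subseteq> carrier (bar_chains G n\<lparr>carrier := bar_cycles G n\<rparr>)"
    by (auto simp: bar_boundaries_def bar_cycles_def bar_boundary_bar_boundary
        intro: bar_boundary_closed)
  show "\<zero>\<^bsub>bar_chains G n\<lparr>carrier := bar_cycles G n\<rparr>\<^esub> \<in> bar_boundaries G n"
    unfolding bar_boundaries_def
    by (rule image_eqI[of _ _ 0]) (simp_all add: bar_chains_simps bar_boundary_def)
  fix c d :: "'a list \<Rightarrow>\<^sub>0 rat" and r :: rat
  assume c: "c \<in> bar_boundaries G n"
  then obtain c' where c': "c' \<in> carrier (bar_chains G (Suc n))" "c = bar_boundary G (Suc n) c'"
    by (auto simp: bar_boundaries_def)
  show "r \<odot>\<^bsub>bar_chains G n\<lparr>carrier := bar_cycles G n\<rparr>\<^esub> c \<in> bar_boundaries G n"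
    unfolding bar_boundaries_def using c' Suc.smult_closed[of r c']
    by (intro image_eqI[of _ _ "r \<odot>\<^bsub>bar_chains G (Suc n)\<^esub> c'"])
      (simp_all add: bar_boundary_smult[where l = n])
  assume "d \<in> bar_boundaries G n"
  then obtain d' where d': "d' \<in> carrier (bar_chains G (Suc n))" "d = bar_boundary G (Suc n) d'"
    by (auto simp: bar_boundaries_def)
  show "c \<oplus>\<^bsub>bar_chains G n\<lparr>carrier := bar_cycles G n\<rparr>\<^esub> d \<in> bar_boundaries G n"
    unfolding bar_boundaries_def using c' d' Suc.a_closed[of c' d']
    by (intro image_eqI[of _ _ "c' + d'"]) (simp_all add: bar_boundary_add bar_chains_simps(3))
qed

lemma module_quotient_module:
  fixes R (structure) and M (structure)
  assumes N: "LinearCombinations.submodule R N M"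
  shows "Module.module R (quotient_module M N)"
proof -
  interpret N: LinearCombinations.submodule R N M by (rule N)
  interpret Module.module R M by (rule N.module)
  have "subgroup N (add_monoid M)"
  proof (rule group.subgroupI[OF M.a_group])
    fix v assume v: "v \<in> N"
    then have vM: "v \<in> carrier M"
      using N.subset by blast
    have "(\<ominus>\<^bsub>R\<^esub> \<one>\<^bsub>R\<^esub>) \<odot>\<^bsub>M\<^esub> v \<in> N"
      by (rule N.smult_closed[OF R.a_inv_closed[OF R.one_closed] v])
    moreover have "(\<ominus>\<^bsub>R\<^esub> \<one>\<^bsub>R\<^esub>) \<odot>\<^bsub>M\<^esub> v = \<ominus>\<^bsub>M\<^esub> v"
      unfolding smult_l_minus[OF R.one_closed vM] smult_one[OF vM] by (rule refl)
    ultimately show "inv\<^bsub>add_monoid M\<^esub> v \<in> N"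
      unfolding a_inv_def by metis
  qed (use N.subset N.zero_closed in \<open>auto simp del: N.zero_closed\<close>)
  then have "additive_subgroup N M"
    by (rule additive_subgroup.intro)
  then interpret Q: abelian_subgroup N M
    by (rule abelian_subgroupI3) (rule M.abelian_group_axioms)
  have carrier: "carrier (quotient_module M N) = (\<lambda>v. N +>\<^bsub>M\<^esub> v) ` carrier M"
    by (auto simp: quotient_module_def A_RCOSETS_def')
  have add: "(N +>\<^bsub>M\<^esub> v) \<oplus>\<^bsub>quotient_module M N\<^esub> (N +>\<^bsub>M\<^esub> w) = N +>\<^bsub>M\<^esub> (v \<oplus>\<^bsub>M\<^esub> w)"
    if "v \<in> carrier M" "w \<in> carrier M" for v w
    using that by (simp add: quotient_module_def Q.a_rcos_sum)
  have zero: "\<zero>\<^bsub>quotient_module M N\<^esub> = N +>\<^bsub>M\<^esub> \<zero>\<^bsub>M\<^esub>"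
    using N.subset by (simp add: quotient_module_def M.a_coset_add_zero)
  have smult: "r \<odot>\<^bsub>quotient_module M N\<^esub> (N +>\<^bsub>M\<^esub> v) = N +>\<^bsub>M\<^esub> (r \<odot>\<^bsub>M\<^esub> v)"
    if r: "r \<in> carrier R" and v: "v \<in> carrier M" for r v
  proof -
    have "N +>\<^bsub>M\<^esub> (r \<odot>\<^bsub>M\<^esub> w) = N +>\<^bsub>M\<^esub> (r \<odot>\<^bsub>M\<^esub> v)" if w: "w \<in> N +>\<^bsub>M\<^esub> v" for w
    proof -
      from w obtain h where h: "h \<in> N" "w = h \<oplus>\<^bsub>M\<^esub> v"
        by (auto simp: a_r_coset_def r_coset_def)
      then have "r \<odot>\<^bsub>M\<^esub> w = r \<odot>\<^bsub>M\<^esub> h \<oplus>\<^bsub>M\<^esub> r \<odot>\<^bsub>M\<^esub> v"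
        using r v N.subset by (simp add: smult_r_distr subset_iff)
      moreover have "r \<odot>\<^bsub>M\<^esub> h \<in> N"
        using h r by simp
      ultimately have "r \<odot>\<^bsub>M\<^esub> w \<in> N +>\<^bsub>M\<^esub> (r \<odot>\<^bsub>M\<^esub> v)"
        by (auto simp: a_r_coset_def r_coset_def)
      then show ?thesis
        using r v by (intro M.a_repr_independence[symmetric] Q.a_subgroup) auto
    qed
    moreover have "N +>\<^bsub>M\<^esub> v \<noteq> {}"
      using Q.a_rcos_self[OF v] by blast
    ultimately have "(\<Union>w\<in>N +>\<^bsub>M\<^esub> v. N +>\<^bsub>M\<^esub> (r \<odot>\<^bsub>M\<^esub> w)) = N +>\<^bsub>M\<^esub> (r \<odot>\<^bsub>M\<^esub> v)"
      by (intro SUP_eq_const)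
    then show ?thesis
      by (simp only: quotient_module_def module.simps)
  qed
  show ?thesis
  proof (rule moduleI)
    show "abelian_group (quotient_module M N)"
    proof (rule abelian_groupI)
      fix x assume "x \<in> carrier (quotient_module M N)"
      then obtain v where v: "v \<in> carrier M" "x = N +>\<^bsub>M\<^esub> v"
        by (auto simp: carrier)
      then show "\<exists>y\<in>carrier (quotient_module M N).
          y \<oplus>\<^bsub>quotient_module M N\<^esub> x = \<zero>\<^bsub>quotient_module M N\<^esub>"
        by (intro bexI[of _ "N +>\<^bsub>M\<^esub> (\<ominus>\<^bsub>M\<^esub> v)"]) (auto simp: carrier add zero M.l_neg)
    qed (auto simp: carrier add zero M.a_ac)
  qed (auto simp: carrier add smult smult_l_distr smult_r_distr smult_assoc1 R.cring_axioms)
qed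

lemma (in group) vectorspace_group_homology: "vectorspace class_ring (group_homology G n)"
  unfolding group_homology_def
  by (intro vectorspace.intro module_quotient_module submodule_bar_boundaries
      class_field.field_axioms)


section \<open>The action on the abelianization\<close>

definition abelianization :: "('a, 'b) monoid_scheme \<Rightarrow> 'a set monoid" where
  "abelianization G = G Mod derived G (carrier G)"

definition ab_action :: "('a, 'b) monoid_scheme \<Rightarrow> ('a \<Rightarrow> 'a) \<Rightarrow> 'a set \<Rightarrow> 'a set" where
  "ab_action G f = (\<lambda>C\<in>carrier (abelianization G). f ` C)"

lemma carrier_AutoGroup: "carrier (AutoGroup G) = auto G"
  by (simp add: AutoGroup_def)

lemma one_AutoGroup: "\<one>\<^bsub>AutoGroup G\<^esub> = (\<lambda>x\<in>carrier G. x)"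
  by (simp add: AutoGroup_def BijGroup_def)

lemma mult_AutoGroup:
  "f \<in> auto G \<Longrightarrow> g \<in> auto G \<Longrightarrow> f \<otimes>\<^bsub>AutoGroup G\<^esub> g = compose (carrier G) f g"
  by (simp add: AutoGroup_def BijGroup_def auto_def)

lemma auto_iff:
  "f \<in> auto G \<longleftrightarrow> f \<in> hom G G \<and> f \<in> extensional (carrier G) \<and> bij_betw f (carrier G) (carrier G)"
  by (auto simp: auto_def Bij_def)

lemma auto_closed: "f \<in> auto G \<Longrightarrow> x \<in> carrier G \<Longrightarrow> f x \<in> carrier G"
  by (auto simp: auto_iff hom_def)

lemma (in group) auto_group_hom: "f \<in> auto G \<Longrightarrow> group_hom G G f"
  by (simp add: auto_iff group_hom_def group_hom_axioms_def is_group)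

lemma hom_AutoGroupI:
  assumes A: "group A" and H: "group H"
    and hom: "\<And>f. f \<in> carrier A \<Longrightarrow> \<Theta> f \<in> hom H H"
    and ext: "\<And>f. f \<in> carrier A \<Longrightarrow> \<Theta> f \<in> extensional (carrier H)"
    and one: "\<And>x. x \<in> carrier H \<Longrightarrow> \<Theta> \<one>\<^bsub>A\<^esub> x = x"
    and mult: "\<And>f g x. f \<in> carrier A \<Longrightarrow> g \<in> carrier A \<Longrightarrow> x \<in> carrier H \<Longrightarrow>
                 \<Theta> (f \<otimes>\<^bsub>A\<^esub> g) x = \<Theta> f (\<Theta> g x)"
  shows "\<Theta> \<in> hom A (AutoGroup H)"
proof -
  interpret A: group A by (rule A)
  have auto: "\<Theta> f \<in> auto H" if f: "f \<in> carrier A" for f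
  proof -
    have "bij_betw (\<Theta> f) (carrier H) (carrier H)"
    proof (rule bij_betw_byWitness[where f' = "\<Theta> (inv\<^bsub>A\<^esub> f)"])
      show "\<forall>x\<in>carrier H. \<Theta> (inv\<^bsub>A\<^esub> f) (\<Theta> f x) = x" "\<forall>x\<in>carrier H. \<Theta> f (\<Theta> (inv\<^bsub>A\<^esub> f) x) = x"
        using f by (simp_all flip: mult add: one)
      show "\<Theta> f ` carrier H \<subseteq> carrier H" "\<Theta> (inv\<^bsub>A\<^esub> f) ` carrier H \<subseteq> carrier H"
        using hom[of f] hom[of "inv\<^bsub>A\<^esub> f"] f by (auto simp: hom_def)
    qed
    then show ?thesis
      using hom ext f by (simp add: auto_iff)
  qed
  show ?thesis
  proof (rule homI)
    fix f g assume fg: "f \<in> carrier A" "g \<in> carrier A"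
    have "\<Theta> (f \<otimes>\<^bsub>A\<^esub> g) = compose (carrier H) (\<Theta> f) (\<Theta> g)"
      by (rule extensionalityI[of _ "carrier H"])
        (use fg in \<open>auto simp: ext mult compose_eq compose_extensional\<close>)
    then show "\<Theta> (f \<otimes>\<^bsub>A\<^esub> g) = \<Theta> f \<otimes>\<^bsub>AutoGroup H\<^esub> \<Theta> g"
      using fg by (simp add: mult_AutoGroup auto)
  qed (simp add: carrier_AutoGroup auto)
qed

lemma (in group) carrier_abelianization:
  "carrier (abelianization G) = (\<lambda>x. derived G (carrier G) #> x) ` carrier G"
  by (auto simp: abelianization_def FactGroup_def RCOSETS_def)

lemma (in group) comm_group_abelianization: "comm_group (abelianization G)"
  unfolding abelianization_def by (rule derived_quot_is_comm_group)

lemma (in group) ab_action_coset: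
  assumes f: "f \<in> auto G" and x: "x \<in> carrier G"
  shows "ab_action G f (derived G (carrier G) #> x) = derived G (carrier G) #> f x"
proof -
  interpret f: group_hom G G f by (rule auto_group_hom[OF f])
  have D: "derived G (carrier G) \<subseteq> carrier G"
    by (rule derived_in_carrier) simp
  have "f ` derived G (carrier G) = derived G (carrier G)"
    using f.derived_img[of "carrier G"] f by (simp add: auto_iff bij_betw_def)
  moreover have "f ` (derived G (carrier G) #> x) = f ` derived G (carrier G) #> f x"
    using D x unfolding r_coset_def by (force simp: subset_iff image_iff)
  ultimately show ?thesis
    using x by (simp add: ab_action_def carrier_abelianization)
qed

lemma (in group) ab_action_hom: "ab_action G \<in> hom (AutoGroup G) (AutoGroup (abelianization G))"
proof (rule hom_AutoGroupI)
  let ?D = "derived G (carrier G)"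
  interpret D: normal ?D G by (rule derived_self_is_normal)
  have mult: "(?D #> x) \<otimes>\<^bsub>abelianization G\<^esub> (?D #> y) = ?D #> (x \<otimes> y)"
    if "x \<in> carrier G" "y \<in> carrier G" for x y
    using that by (simp add: abelianization_def FactGroup_def D.rcos_sum)
  show "group (AutoGroup G)"
    by (rule AutoGroup)
  show "group (abelianization G)"
    using comm_group_abelianization by (rule comm_group.axioms)
  fix f assume f: "f \<in> carrier (AutoGroup G)"
  then show "ab_action G f \<in> hom (abelianization G) (abelianization G)"
    by (auto intro!: homI simp: carrier_AutoGroup carrier_abelianization ab_action_coset mult
        auto_closed group_hom.hom_mult[OF auto_group_hom])
  show "ab_action G f \<in> extensional (carrier (abelianization G))"
    by (simp add: ab_action_def)
  fix g C assume g: "g \<in> carrier (AutoGroup G)" and C: "C \<in> carrier (abelianization G)"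
  from C obtain x where x: "x \<in> carrier G" "C = ?D #> x"
    by (auto simp: carrier_abelianization)
  moreover have "compose (carrier G) f g \<in> auto G"
    using monoid.m_closed[OF group.is_monoid[OF AutoGroup] f g] f g
    by (simp add: carrier_AutoGroup mult_AutoGroup)
  ultimately show "ab_action G (f \<otimes>\<^bsub>AutoGroup G\<^esub> g) C = ab_action G f (ab_action G g C)"
    using f g by (simp add: carrier_AutoGroup mult_AutoGroup ab_action_coset auto_closed compose_eq)
next
  fix C assume "C \<in> carrier (abelianization G)"
  then show "ab_action G \<one>\<^bsub>AutoGroup G\<^esub> C = C"
    using id_in_auto by (auto simp: carrier_abelianization one_AutoGroup ab_action_coset)
qed

text \<open>
  The abelianization of the free group on \<open>S\<close> is free abelian on \<open>S\<close>, so that for finite \<open>S\<close> its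
  automorphism group is \<open>GL\<^bsub>|S|\<^esub>(\<int>)\<close>.
\<close>

lemma abelianization_free_group: "abelianization (free_group S) \<cong> free_Abelian_group S"
proof -
  let ?F = "free_group S" and ?A = "free_Abelian_group S"
  let ?D = "derived ?F (carrier ?F)"
  let ?\<phi> = "free_lift ?A frag_of"
  interpret F: group ?F by (rule group_free_group)
  interpret A: comm_group ?A by (rule abelian_free_Abelian_group)
  interpret Q: comm_group "?F Mod ?D" by (rule F.derived_quot_is_comm_group)
  interpret D: normal ?D ?F by (rule F.derived_self_is_normal)
  have frag: "frag_of \<in> S \<rightarrow> carrier ?A"
    by simp
  interpret \<phi>: group_hom ?F ?A ?\<phi>
    by (rule free_lift_group_hom) (simp_all add: A.is_group)
  have coset: "(\<lambda>w. ?D #>\<^bsub>?F\<^esub> w) \<in> hom ?F (?F Mod ?D)"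
    by (rule D.r_coset_hom_Mod)
  have "(\<lambda>a. ?D #>\<^bsub>?F\<^esub> gen a) ` S \<subseteq> carrier (?F Mod ?D)"
    using coset by (auto simp: hom_def Pi_iff)
  then obtain \<psi> where \<psi>: "\<psi> \<in> hom ?A (?F Mod ?D)"
    and \<psi>_frag: "\<And>a. a \<in> S \<Longrightarrow> \<psi> (frag_of a) = ?D #>\<^bsub>?F\<^esub> gen a"
    using Q.free_Abelian_group_universal[of "\<lambda>a. ?D #>\<^bsub>?F\<^esub> gen a" S] by auto
  interpret \<psi>: group_hom ?A "?F Mod ?D" \<psi>
    using \<psi> by (simp add: group_hom_def group_hom_axioms_def A.is_group Q.is_group)
  have \<psi>\<phi>: "\<psi> (?\<phi> w) = ?D #>\<^bsub>?F\<^esub> w" if "w \<in> carrier ?F" for w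
  proof -
    have "(\<psi> \<circ> ?\<phi>) w = (\<lambda>w. ?D #>\<^bsub>?F\<^esub> w) w"
    proof (rule free_group_hom_eqI[OF Q.is_group _ coset _ that])
      show "\<psi> \<circ> ?\<phi> \<in> hom ?F (?F Mod ?D)"
        using \<phi>.homh \<psi> by (rule Group.hom_compose)
    qed (simp add: free_lift_gen[OF A.is_group frag] \<psi>_frag)
    then show ?thesis by simp
  qed
  have "kernel ?F ?A ?\<phi> = ?D"
  proof
    show "kernel ?F ?A ?\<phi> \<subseteq> ?D"
    proof
      fix w assume "w \<in> kernel ?F ?A ?\<phi>"
      then have w: "w \<in> carrier ?F" "?\<phi> w = \<one>\<^bsub>?A\<^esub>"
        by (auto simp: kernel_def)
      then have "?D #>\<^bsub>?F\<^esub> w = ?D"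
        using \<psi>\<phi>[OF w(1)] \<psi>.hom_one by (simp add: FactGroup_def)
      then show "w \<in> ?D"
        using F.coset_join1[OF _ w(1)] D.is_subgroup by simp
    qed
    have "derived ?A (?\<phi> ` carrier ?F) = {\<one>\<^bsub>?A\<^esub>}"
      by (rule A.derived_eq_singleton) (auto simp del: carrier_free_Abelian_group_iff)
    then have "?\<phi> ` ?D = {\<one>\<^bsub>?A\<^esub>}"
      using \<phi>.derived_img[of "carrier ?F"] by simp
    then show "?D \<subseteq> kernel ?F ?A ?\<phi>"
      using D.subset by (auto simp: kernel_def)
  qed
  moreover have "?\<phi> ` carrier ?F = carrier ?A"
  proof
    show "?\<phi> ` carrier ?F \<subseteq> carrier ?A"
      by (auto simp del: carrier_free_Abelian_group_iff)
    show "carrier ?A \<subseteq> ?\<phi> ` carrier ?F"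
    proof
      fix c assume "c \<in> carrier ?A"
      then have "Poly_Mapping.keys c \<subseteq> S" by simp
      then show "c \<in> ?\<phi> ` carrier ?F"
      proof (rule free_Abelian_group_induct)
        show "0 \<in> ?\<phi> ` carrier ?F"
          by (rule image_eqI[of _ _ "\<one>\<^bsub>?F\<^esub>"]) (simp_all add: \<phi>.hom_one)
      next
        fix x y assume "x \<in> ?\<phi> ` carrier ?F" "y \<in> ?\<phi> ` carrier ?F"
        then obtain u v where uv: "u \<in> carrier ?F" "v \<in> carrier ?F" "x = ?\<phi> u" "y = ?\<phi> v"
          by auto
        then have "Poly_Mapping.keys y \<subseteq> S"
          using \<phi>.hom_closed[of v] by simp
        then show "x - y \<in> ?\<phi> ` carrier ?F"
          using uv by (intro image_eqI[of _ _ "u \<otimes>\<^bsub>?F\<^esub> inv\<^bsub>?F\<^esub> v"]) auto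
      next
        fix a assume "a \<in> S"
        then show "frag_of a \<in> ?\<phi> ` carrier ?F"
          by (intro image_eqI[of _ _ "gen a"]) (simp_all add: free_lift_gen[OF A.is_group frag])
      qed
    qed
  qed
  ultimately show ?thesis
    using \<phi>.FactGroup_iso by (simp add: abelianization_def)
qed


section \<open>The groups\<close>

text \<open>The generator \<open>x\<^sub>i\<close> of \<open>F\<^sub>n\<^sub>,\<^sub>k\<close> is \<open>gen (Inl i)\<close>, and \<open>y\<^sub>j\<close> is \<open>gen (Inr j)\<close>.\<close>

definition F_nk :: "nat \<Rightarrow> nat \<Rightarrow> (nat + nat) word monoid" where
  "F_nk n k = free_group ({1..n} <+> {1..k})"

definition F_n :: "nat \<Rightarrow> nat word monoid" where
  "F_n n = free_group {1..n}"

definition conj_class :: "('a, 'b) monoid_scheme \<Rightarrow> 'a \<Rightarrow> 'a set" where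
  "conj_class G z = {g \<otimes>\<^bsub>G\<^esub> z \<otimes>\<^bsub>G\<^esub> inv\<^bsub>G\<^esub> g | g. g \<in> carrier G}"

definition A_nk :: "nat \<Rightarrow> nat \<Rightarrow> ((nat + nat) word \<Rightarrow> (nat + nat) word) monoid" where
  "A_nk n k = AutoGroup (F_nk n k)
     \<lparr>carrier := {f \<in> carrier (AutoGroup (F_nk n k)).
        \<forall>i\<in>{1..k}. conj_class (F_nk n k) (f (gen (Inr i))) = conj_class (F_nk n k) (gen (Inr i))}\<rparr>"

definition proj_F :: "nat \<Rightarrow> (nat + nat) word \<Rightarrow> nat word" where
  "proj_F n = free_lift (F_n n) (case_sum gen (\<lambda>_. \<one>\<^bsub>F_n n\<^esub>))"

definition pi_nk :: "nat \<Rightarrow> nat \<Rightarrow> ((nat + nat) word \<Rightarrow> (nat + nat) word) \<Rightarrow> (nat word \<Rightarrow> nat word)" where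
  "pi_nk n k f = (THE g. g \<in> carrier (AutoGroup (F_n n)) \<and>
     (\<forall>w\<in>carrier (F_nk n k). g (proj_F n w) = proj_F n (f w)))"

definition K_nk :: "nat \<Rightarrow> nat \<Rightarrow> ((nat + nat) word \<Rightarrow> (nat + nat) word) set" where
  "K_nk n k = kernel (A_nk n k) (AutoGroup (F_n n)) (pi_nk n k)"

definition IA_nk :: "nat \<Rightarrow> nat \<Rightarrow> ((nat + nat) word \<Rightarrow> (nat + nat) word) set" where
  "IA_nk n k = kernel (AutoGroup (F_nk n k)) (AutoGroup (abelianization (F_nk n k)))
     (ab_action (F_nk n k))"

definition KIA_nk :: "nat \<Rightarrow> nat \<Rightarrow> ((nat + nat) word \<Rightarrow> (nat + nat) word) monoid" where
  "KIA_nk n k = AutoGroup (F_nk n k)\<lparr>carrier := K_nk n k \<inter> IA_nk n k\<rparr>"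

lemma group_F_nk: "group (F_nk n k)"
  by (simp add: F_nk_def group_free_group)

lemma group_F_n: "group (F_n n)"
  by (simp add: F_n_def group_free_group)

lemma proj_F_group_hom: "group_hom (F_nk n k) (F_n n) (proj_F n)"
  unfolding F_nk_def proj_F_def
  by (rule free_lift_group_hom[OF group_F_n])
    (auto simp: F_n_def group.is_monoid[OF group_free_group] monoid.one_closed)

lemma proj_F_gen:
  "i \<in> {1..n} \<Longrightarrow> proj_F n (gen (Inl i)) = gen i"
  "proj_F n (gen (Inr j)) = \<one>\<^bsub>F_n n\<^esub>"
proof -
  have *: "case_sum gen (\<lambda>_. \<one>\<^bsub>F_n n\<^esub>) \<in> {1..n} <+> UNIV \<rightarrow> carrier (F_n n)"
    by (auto simp: F_n_def group.is_monoid[OF group_free_group] monoid.one_closed)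
  show "i \<in> {1..n} \<Longrightarrow> proj_F n (gen (Inl i)) = gen i"
    "proj_F n (gen (Inr j)) = \<one>\<^bsub>F_n n\<^esub>"
    unfolding proj_F_def by (subst free_lift_gen[OF group_F_n *]; force)+
qed

definition incl_F :: "nat \<Rightarrow> nat \<Rightarrow> nat word \<Rightarrow> (nat + nat) word" where
  "incl_F n k = free_lift (F_nk n k) (\<lambda>i. gen (Inl i))"

lemma incl_F_group_hom: "group_hom (F_n n) (F_nk n k) (incl_F n k)"
  unfolding F_n_def incl_F_def
  by (rule free_lift_group_hom[OF group_F_nk]) (auto simp: F_nk_def)

lemma incl_F_gen: "i \<in> {1..n} \<Longrightarrow> incl_F n k (gen i) = gen (Inl i)"
  unfolding incl_F_def
  by (rule free_lift_gen[OF group_F_nk, of _ "{1..n}"]) (auto simp: F_nk_def)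

lemma proj_incl_F:
  assumes "v \<in> carrier (F_n n)"
  shows "proj_F n (incl_F n k v) = v"
proof -
  interpret p: group_hom "F_nk n k" "F_n n" "proj_F n" by (rule proj_F_group_hom)
  interpret s: group_hom "F_n n" "F_nk n k" "incl_F n k" by (rule incl_F_group_hom)
  have "(proj_F n \<circ> incl_F n k) v = id v"
  proof (rule free_group_hom_eqI[where S = "{1..n}" and f = "proj_F n \<circ> incl_F n k" and g = id,
        OF group_F_n])
    show "proj_F n \<circ> incl_F n k \<in> hom (free_group {1..n}) (F_n n)"
      using Group.hom_compose[OF s.homh p.homh] by (simp add: F_n_def)
    show "id \<in> hom (free_group {1..n}) (F_n n)"
      by (simp add: F_n_def hom_def)
  qed (use assms in \<open>auto simp: proj_F_gen incl_F_gen F_n_def\<close>)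
  then show ?thesis by simp
qed

lemma kernel_proj_F:
  "kernel (F_nk n k) (F_n n) (proj_F n) = normal_closure (F_nk n k) ((\<lambda>j. gen (Inr j)) ` {1..k})"
proof
  interpret p: group_hom "F_nk n k" "F_n n" "proj_F n" by (rule proj_F_group_hom)
  interpret s: group_hom "F_n n" "F_nk n k" "incl_F n k" by (rule incl_F_group_hom)
  let ?Y = "(\<lambda>j. gen (Inr j)) ` {1..k}"
  let ?N = "normal_closure (F_nk n k) ?Y"
  have Y: "?Y \<subseteq> carrier (F_nk n k)"
    by (auto simp: F_nk_def)
  have "?Y \<subseteq> kernel (F_nk n k) (F_n n) (proj_F n)"
    using Y by (auto simp: kernel_def proj_F_gen)
  then show "?N \<subseteq> kernel (F_nk n k) (F_n n) (proj_F n)"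
    unfolding normal_closure_def by (rule hull_minimal) (rule p.normal_kernel)
  interpret N: normal ?N "F_nk n k"
    by (rule p.G.normal_closure_normal[OF Y])
  have YN: "?Y \<subseteq> ?N"
    unfolding normal_closure_def by (rule hull_subset)
  have Q: "group (F_nk n k Mod ?N)"
    by (rule N.factorgroup_is_group)
  show "kernel (F_nk n k) (F_n n) (proj_F n) \<subseteq> ?N"
  proof
    fix w assume "w \<in> kernel (F_nk n k) (F_n n) (proj_F n)"
    then have w: "w \<in> carrier (F_nk n k)" "proj_F n w = \<one>\<^bsub>F_n n\<^esub>"
      by (auto simp: kernel_def)
    have "(\<lambda>w. ?N #>\<^bsub>F_nk n k\<^esub> w) w =
        ((\<lambda>w. ?N #>\<^bsub>F_nk n k\<^esub> w) \<circ> (incl_F n k \<circ> proj_F n)) w"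
    proof (rule free_group_hom_eqI[OF Q])
      show "(\<lambda>w. ?N #>\<^bsub>F_nk n k\<^esub> w) \<in> hom (free_group ({1..n} <+> {1..k})) (F_nk n k Mod ?N)"
        using N.r_coset_hom_Mod by (simp add: F_nk_def)
      show "(\<lambda>w. ?N #>\<^bsub>F_nk n k\<^esub> w) \<circ> (incl_F n k \<circ> proj_F n) \<in>
          hom (free_group ({1..n} <+> {1..k})) (F_nk n k Mod ?N)"
        using Group.hom_compose[OF Group.hom_compose[OF p.homh s.homh] N.r_coset_hom_Mod]
        by (simp add: F_nk_def)
      show "w \<in> carrier (free_group ({1..n} <+> {1..k}))"
        using w by (simp add: F_nk_def)
      fix a :: "nat + nat" assume "a \<in> {1..n} <+> {1..k}"
      then show "?N #>\<^bsub>F_nk n k\<^esub> gen a =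
          ((\<lambda>w. ?N #>\<^bsub>F_nk n k\<^esub> w) \<circ> (incl_F n k \<circ> proj_F n)) (gen a)"
      proof (elim PlusE)
        fix j assume j: "j \<in> {1..k}" "a = Inr j"
        then have "gen (Inr j) \<in> ?N"
          using YN by auto
        then have "?N #>\<^bsub>F_nk n k\<^esub> gen (Inr j) = ?N"
          by (rule N.rcos_const[OF p.G.is_group])
        then show ?thesis
          using j N.subset by (simp add: proj_F_gen)
      qed (simp add: proj_F_gen incl_F_gen)
    qed
    then have "?N #>\<^bsub>F_nk n k\<^esub> w = ?N"
      using w N.subset by simp
    then show "w \<in> ?N"
      using p.G.coset_join1[OF _ w(1)] N.is_subgroup by blast
  qed
qed

lemma (in group) image_conj_class:
  assumes f: "f \<in> auto G" and z: "z \<in> carrier G"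
  shows "f ` conj_class G z = conj_class G (f z)"
proof -
  interpret f: group_hom G G f by (rule auto_group_hom[OF f])
  have surj: "f ` carrier G = carrier G"
    using f by (simp add: auto_iff bij_betw_def)
  have conj: "conj_class G u = (\<lambda>g. g \<otimes> u \<otimes> inv g) ` carrier G" for u
    by (auto simp: conj_class_def)
  have "f ` conj_class G z = (\<lambda>g. f g \<otimes> f z \<otimes> inv (f g)) ` carrier G"
    using z by (simp add: conj image_image cong: image_cong_simp)
  also have "\<dots> = (\<lambda>g. g \<otimes> f z \<otimes> inv g) ` (f ` carrier G)"
    by (simp add: image_image)
  finally show ?thesis
    unfolding surj conj .
qed

lemma (in group) inv_AutoGroup_apply:
  assumes "f \<in> auto G" "x \<in> carrier G"
  shows "(inv\<^bsub>AutoGroup G\<^esub> f) (f x) = x"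
proof -
  interpret A: group "AutoGroup G" by (rule AutoGroup)
  have "inv\<^bsub>AutoGroup G\<^esub> f \<in> auto G"
    using A.inv_closed[of f] assms by (simp add: carrier_AutoGroup)
  then show ?thesis
    using A.l_inv[of f] assms
    by (simp add: carrier_AutoGroup mult_AutoGroup one_AutoGroup fun_eq_iff compose_def
        split: if_splits)
qed

lemma subgroup_A_nk: "subgroup (carrier (A_nk n k)) (AutoGroup (F_nk n k))"
proof -
  let ?F = "F_nk n k"
  interpret F: group ?F by (rule group_F_nk)
  interpret A: group "AutoGroup ?F" by (rule F.AutoGroup)
  have y: "gen (Inr i) \<in> carrier ?F" if "i \<in> {1..k}" for i
    using that by (auto simp: F_nk_def)
  have sub: "conj_class ?F z \<subseteq> carrier ?F" if "z \<in> carrier ?F" for z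
    using that by (auto simp: conj_class_def)
  have mem: "f \<in> carrier (A_nk n k) \<longleftrightarrow> f \<in> carrier (AutoGroup ?F) \<and>
      (\<forall>i\<in>{1..k}. f ` conj_class ?F (gen (Inr i)) = conj_class ?F (gen (Inr i)))" for f
    by (simp add: A_nk_def carrier_AutoGroup F.image_conj_class y cong: conj_cong)
  show ?thesis
  proof (rule A.subgroupI)
    have "\<one>\<^bsub>AutoGroup ?F\<^esub> ` conj_class ?F (gen (Inr i)) = conj_class ?F (gen (Inr i))"
      if "i \<in> {1..k}" for i
      using sub[OF y[OF that]] by (force simp: one_AutoGroup)
    then have "\<one>\<^bsub>AutoGroup ?F\<^esub> \<in> carrier (A_nk n k)"
      by (simp add: mem)
    then show "carrier (A_nk n k) \<noteq> {}" by auto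
  next
    fix f assume f: "f \<in> carrier (A_nk n k)"
    have "(inv\<^bsub>AutoGroup ?F\<^esub> f) ` conj_class ?F (gen (Inr i)) = conj_class ?F (gen (Inr i))"
      if i: "i \<in> {1..k}" for i
    proof -
      have "(inv\<^bsub>AutoGroup ?F\<^esub> f) ` f ` conj_class ?F (gen (Inr i)) = conj_class ?F (gen (Inr i))"
        using f sub[OF y[OF i]]
        by (force simp: image_image mem carrier_AutoGroup F.inv_AutoGroup_apply)
      then show ?thesis
        using f i by (simp add: mem)
    qed
    then show "inv\<^bsub>AutoGroup ?F\<^esub> f \<in> carrier (A_nk n k)"
      using f by (simp add: mem)
  next
    fix f g assume fg: "f \<in> carrier (A_nk n k)" "g \<in> carrier (A_nk n k)"
    have "compose (carrier ?F) f g ` conj_class ?F (gen (Inr i)) = conj_class ?F (gen (Inr i))"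
      if i: "i \<in> {1..k}" for i
    proof -
      have "compose (carrier ?F) f g ` conj_class ?F (gen (Inr i)) =
          f ` g ` conj_class ?F (gen (Inr i))"
        using sub[OF y[OF i]] by (force simp: compose_def image_iff)
      then show ?thesis
        using fg i by (simp add: mem)
    qed
    then show "f \<otimes>\<^bsub>AutoGroup ?F\<^esub> g \<in> carrier (A_nk n k)"
      using fg A.m_closed[of f g] by (simp add: mem carrier_AutoGroup mult_AutoGroup)
  qed (simp add: mem subset_iff)
qed

lemma A_nk_eq: "A_nk n k = AutoGroup (F_nk n k)\<lparr>carrier := carrier (A_nk n k)\<rparr>"
  by (simp add: A_nk_def)

lemma group_A_nk: "group (A_nk n k)"
  by (subst A_nk_eq) (rule subgroup.subgroup_is_group[OF subgroup_A_nk group.AutoGroup[OF group_F_nk]])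

lemma proj_F_incl_F_A_nk:
  assumes f: "f \<in> carrier (A_nk n k)" and w: "w \<in> carrier (F_nk n k)"
  shows "proj_F n (f (incl_F n k (proj_F n w))) = proj_F n (f w)"
proof -
  let ?F = "F_nk n k"
  interpret p: group_hom ?F "F_n n" "proj_F n" by (rule proj_F_group_hom)
  interpret s: group_hom "F_n n" ?F "incl_F n k" by (rule incl_F_group_hom)
  have f_auto: "f \<in> auto ?F"
    and f_conj: "\<And>i. i \<in> {1..k} \<Longrightarrow> conj_class ?F (f (gen (Inr i))) = conj_class ?F (gen (Inr i))"
    using f by (auto simp: A_nk_def carrier_AutoGroup)
  interpret f: group_hom ?F ?F f by (rule p.G.auto_group_hom[OF f_auto])
  have pf: "proj_F n \<circ> f \<in> hom ?F (F_n n)"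
    by (rule Group.hom_compose[OF f.homh p.homh])
  have "((proj_F n \<circ> f) \<circ> (incl_F n k \<circ> proj_F n)) w = (proj_F n \<circ> f) w"
  proof (rule free_group_hom_eqI[where S = "{1..n} <+> {1..k}" and g = "proj_F n \<circ> f"
        and f = "(proj_F n \<circ> f) \<circ> (incl_F n k \<circ> proj_F n)", OF group_F_n])
    show "(proj_F n \<circ> f) \<circ> (incl_F n k \<circ> proj_F n) \<in> hom (free_group ({1..n} <+> {1..k})) (F_n n)"
      using Group.hom_compose[OF Group.hom_compose[OF p.homh s.homh] pf] by (simp add: F_nk_def)
    show "proj_F n \<circ> f \<in> hom (free_group ({1..n} <+> {1..k})) (F_n n)"
      using pf by (simp add: F_nk_def)
    show "w \<in> carrier (free_group ({1..n} <+> {1..k}))"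
      using w by (simp add: F_nk_def)
    fix a :: "nat + nat" assume "a \<in> {1..n} <+> {1..k}"
    then show "((proj_F n \<circ> f) \<circ> (incl_F n k \<circ> proj_F n)) (gen a) = (proj_F n \<circ> f) (gen a)"
    proof (elim PlusE)
      fix j assume j: "j \<in> {1..k}" "a = Inr j"
      have y: "gen (Inr j) \<in> carrier ?F"
        using j by (auto simp: F_nk_def)
      have "f (gen (Inr j)) \<in> conj_class ?F (f (gen (Inr j)))"
        unfolding conj_class_def using y by (intro CollectI exI[of _ "\<one>\<^bsub>?F\<^esub>"]) simp
      then obtain g where g: "g \<in> carrier ?F"
        "f (gen (Inr j)) = g \<otimes>\<^bsub>?F\<^esub> gen (Inr j) \<otimes>\<^bsub>?F\<^esub> inv\<^bsub>?F\<^esub> g"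
        unfolding f_conj[OF j(1)] by (auto simp: conj_class_def)
      then have "proj_F n (f (gen (Inr j))) = \<one>\<^bsub>F_n n\<^esub>"
        using y j by (simp add: proj_F_gen)
      then show ?thesis
        using j by (simp add: proj_F_gen)
    qed (simp add: proj_F_gen incl_F_gen)
  qed
  then show ?thesis by simp
qed

text \<open>The automorphism in the definition of \<open>pi_nk\<close> exists, is unique, and depends
  homomorphically on \<open>f\<close>.\<close>

lemma
  shows pi_nk_hom: "pi_nk n k \<in> hom (A_nk n k) (AutoGroup (F_n n))"
    and pi_nk_proj_F: "f \<in> carrier (A_nk n k) \<Longrightarrow> w \<in> carrier (F_nk n k) \<Longrightarrow>
      pi_nk n k f (proj_F n w) = proj_F n (f w)"
proof -
  let ?F = "F_nk n k"
  interpret p: group_hom ?F "F_n n" "proj_F n" by (rule proj_F_group_hom)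
  interpret s: group_hom "F_n n" ?F "incl_F n k" by (rule incl_F_group_hom)
  interpret A: group "A_nk n k" by (rule group_A_nk)
  define \<Theta> where "\<Theta> f = (\<lambda>v\<in>carrier (F_n n). proj_F n (f (incl_F n k v)))" for f
  have auto: "f \<in> auto ?F" if "f \<in> carrier (A_nk n k)" for f
    using that by (simp add: A_nk_def carrier_AutoGroup)
  have \<Theta>: "\<Theta> f (proj_F n w) = proj_F n (f w)"
    if "f \<in> carrier (A_nk n k)" "w \<in> carrier ?F" for f w
    using that by (simp add: \<Theta>_def proj_F_incl_F_A_nk)
  have \<Theta>_hom: "\<Theta> \<in> hom (A_nk n k) (AutoGroup (F_n n))"
  proof (rule hom_AutoGroupI[OF group_A_nk group_F_n])
    fix f assume f: "f \<in> carrier (A_nk n k)"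
    interpret f: group_hom ?F ?F f by (rule p.G.auto_group_hom[OF auto[OF f]])
    show "\<Theta> f \<in> hom (F_n n) (F_n n)"
      by (rule homI) (simp_all add: \<Theta>_def)
    show "\<Theta> f \<in> extensional (carrier (F_n n))"
      by (simp add: \<Theta>_def)
    fix g x assume g: "g \<in> carrier (A_nk n k)" and x: "x \<in> carrier (F_n n)"
    interpret g: group_hom ?F ?F g by (rule p.G.auto_group_hom[OF auto[OF g]])
    have "f \<otimes>\<^bsub>A_nk n k\<^esub> g = compose (carrier ?F) f g"
      using mult_AutoGroup[OF auto[OF f] auto[OF g]] by (simp add: A_nk_def)
    then show "\<Theta> (f \<otimes>\<^bsub>A_nk n k\<^esub> g) x = \<Theta> f (\<Theta> g x)"
      using x \<Theta>[OF f, of "g (incl_F n k x)"] by (simp add: \<Theta>_def[of "compose _ _ _"]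
          \<Theta>_def[of g] compose_eq)
  next
    fix x assume x: "x \<in> carrier (F_n n)"
    then show "\<Theta> \<one>\<^bsub>A_nk n k\<^esub> x = x"
      using one_AutoGroup[of ?F] by (simp add: \<Theta>_def A_nk_def proj_incl_F)
  qed
  have pi: "pi_nk n k f = \<Theta> f" if f: "f \<in> carrier (A_nk n k)" for f
    unfolding pi_nk_def
  proof (rule the_equality)
    show "\<Theta> f \<in> carrier (AutoGroup (F_n n)) \<and>
        (\<forall>w\<in>carrier ?F. \<Theta> f (proj_F n w) = proj_F n (f w))"
      using f \<Theta>_hom \<Theta> by (auto simp: hom_def)
  next
    fix g assume g: "g \<in> carrier (AutoGroup (F_n n)) \<and>
        (\<forall>w\<in>carrier ?F. g (proj_F n w) = proj_F n (f w))"
    show "g = \<Theta> f"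
    proof (rule extensionalityI[of _ "carrier (F_n n)"])
      fix v assume v: "v \<in> carrier (F_n n)"
      then have "g (proj_F n (incl_F n k v)) = proj_F n (f (incl_F n k v))"
        using g by simp
      then show "g v = \<Theta> f v"
        using v by (simp add: proj_incl_F \<Theta>_def)
    qed (use g in \<open>auto simp: carrier_AutoGroup auto_iff \<Theta>_def\<close>)
  qed
  show "pi_nk n k \<in> hom (A_nk n k) (AutoGroup (F_n n))"
    using \<Theta>_hom by (auto simp: hom_def pi)
  show "f \<in> carrier (A_nk n k) \<Longrightarrow> w \<in> carrier ?F \<Longrightarrow> pi_nk n k f (proj_F n w) = proj_F n (f w)"
    by (simp add: pi \<Theta>)
qed

lemma subgroup_KIA_nk: "subgroup (K_nk n k \<inter> IA_nk n k) (AutoGroup (F_nk n k))"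
proof -
  let ?A = "AutoGroup (F_nk n k)"
  interpret F: group "F_nk n k" by (rule group_F_nk)
  have A: "group ?A" by (rule F.AutoGroup)
  have "group_hom (A_nk n k) (AutoGroup (F_n n)) (pi_nk n k)"
    using group_A_nk group.AutoGroup[OF group_F_n] pi_nk_hom
    by (simp add: group_hom_def group_hom_axioms_def)
  then have "subgroup (K_nk n k) (A_nk n k)"
    unfolding K_nk_def by (rule group_hom.subgroup_kernel)
  then have K: "subgroup (K_nk n k) ?A"
    using group.incl_subgroup[OF A subgroup_A_nk] A_nk_eq[of n k] by simp
  have "group_hom ?A (AutoGroup (abelianization (F_nk n k))) (ab_action (F_nk n k))"
    using A group.AutoGroup[OF comm_group.axioms(2)[OF F.comm_group_abelianization]] F.ab_action_hom
    by (simp add: group_hom_def group_hom_axioms_def)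
  then have "subgroup (IA_nk n k) ?A"
    unfolding IA_nk_def by (rule group_hom.subgroup_kernel)
  with K show ?thesis
    by (rule group.subgroups_Inter_pair[OF A])
qed

lemma group_KIA_nk: "group (KIA_nk n k)"
  unfolding KIA_nk_def
  by (rule subgroup.subgroup_is_group[OF subgroup_KIA_nk group.AutoGroup[OF group_F_nk]])

end

theory Submission
  imports Defs
begin

text \<open>
  Write \<open>K\<close> for the group \<open>KIA_nk n k\<close> and \<open>L\<close> for the ring of Laurent polynomials in \<open>t\<close> over \<open>\<rat>\<close>.
  The proof constructs one \<open>L\<close>-valued 2-cocycle on \<open>K\<close> and evaluates it on infinitely many tori,
  that is, on the homology classes of pairs of commuting elements.

  Let \<open>x2_deg\<close> be the exponent sum of \<open>x\<^sub>2\<close>, a homomorphism from the free group \<open>F\<close> to \<open>\<int>\<close>, and let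
  \<open>fox_D\<close> be the crossed homomorphism from \<open>F\<close> to \<open>L\<close> over it that sends \<open>y\<^sub>1\<close> to \<open>1\<close> and all other
  generators to \<open>0\<close>. If \<open>f\<close> in \<open>K\<close> conjugates \<open>y\<^sub>1\<close> by a word of degree \<open>r\<close>, then \<open>f\<close> multiplies the
  values of \<open>fox_D\<close> on the normal closure of the \<open>y\<^sub>j\<close> by \<open>t\<^sup>r\<close>. Since \<open>f\<close> changes \<open>x\<^sub>1\<close> by an
  element of this normal closure, \<open>e f = fox_D (f x\<^sub>1)\<close> satisfies \<open>e (f g) = e f + t\<^sup>r e g\<close>: it is a
  crossed homomorphism on \<open>K\<close> (lemma \<open>crossed_hom\<close>). Its cup product with its own image under
  \<open>t \<mapsto> 1/t\<close> is a 2-cocycle with values in \<open>L\<close> on which \<open>K\<close> acts trivially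
  (lemma \<open>KIA_nk_two_cocycle\<close>).

  The automorphisms \<open>x\<^sub>1 \<mapsto> [x\<^sub>2, y\<^sub>1] x\<^sub>1\<close> and \<open>x\<^sub>1 \<mapsto> x\<^sub>1 [x\<^sub>2\<^sup>m, y\<^sub>1]\<close> lie in \<open>K\<close> and commute, and the value
  of the cocycle on the torus that they define contains the monomial \<open>t\<^sup>m\<close> for every \<open>m \<ge> 2\<close>
  (lemma \<open>KIA_nk_commuting_pair\<close>). So no finite set of exponents contains the supports of all
  values on tori. Both claims follow, as such a finite set exists for every group with
  finite-dimensional second homology (the supports of the values on a finite spanning set) and for
  every finitely presentable group (the supports of the central coordinates of the relators in the
  central extension defined by the cocycle).
\<close>


section \<open>Cocycles, second homology and finite presentability\<close>

text \<open>
  Trivial coefficients: a cocycle with values in \<open>'b\<close> is the same as a central extension of \<open>G\<close>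
  by \<open>'b\<close> together with a set-theoretic section.
\<close>

definition two_cocycle :: "('a, 'm) monoid_scheme \<Rightarrow> ('a \<Rightarrow> 'a \<Rightarrow> 'b::ab_group_add) \<Rightarrow> bool" where
  "two_cocycle G c \<longleftrightarrow>
     (\<forall>f\<in>carrier G. \<forall>g\<in>carrier G. \<forall>h\<in>carrier G.
        c g h + c f (g \<otimes>\<^bsub>G\<^esub> h) = c (f \<otimes>\<^bsub>G\<^esub> g) h + c f g)"

definition cochain_eval :: "('a list \<Rightarrow> rat) \<Rightarrow> ('a list \<Rightarrow>\<^sub>0 rat) \<Rightarrow> rat" where
  "cochain_eval \<kappa> z = (\<Sum>gs\<in>Poly_Mapping.keys z. Poly_Mapping.lookup z gs * \<kappa> gs)"

lemma cochain_eval_superset: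
  assumes "finite A" "Poly_Mapping.keys z \<subseteq> A"
  shows "cochain_eval \<kappa> z = (\<Sum>gs\<in>A. Poly_Mapping.lookup z gs * \<kappa> gs)"
  unfolding cochain_eval_def
  using assms by (intro sum.mono_neutral_left) (auto simp: in_keys_iff)

lemma cochain_eval_0 [simp]: "cochain_eval \<kappa> 0 = 0"
  by (simp add: cochain_eval_def)

lemma cochain_eval_single [simp]: "cochain_eval \<kappa> (Poly_Mapping.single gs r) = r * \<kappa> gs"
  by (subst cochain_eval_superset[of "{gs}"]) auto

lemma cochain_eval_add: "cochain_eval \<kappa> (y + z) = cochain_eval \<kappa> y + cochain_eval \<kappa> z"
proof -
  let ?A = "Poly_Mapping.keys y \<union> Poly_Mapping.keys z"
  have "cochain_eval \<kappa> (y + z) = (\<Sum>gs\<in>?A. Poly_Mapping.lookup (y + z) gs * \<kappa> gs)"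
    using keys_add[of y z] by (intro cochain_eval_superset) auto
  also have "\<dots> = (\<Sum>gs\<in>?A. Poly_Mapping.lookup y gs * \<kappa> gs) +
      (\<Sum>gs\<in>?A. Poly_Mapping.lookup z gs * \<kappa> gs)"
    by (simp add: lookup_add distrib_right sum.distrib)
  also have "(\<Sum>gs\<in>?A. Poly_Mapping.lookup y gs * \<kappa> gs) = cochain_eval \<kappa> y"
    by (rule cochain_eval_superset[symmetric]) auto
  also have "(\<Sum>gs\<in>?A. Poly_Mapping.lookup z gs * \<kappa> gs) = cochain_eval \<kappa> z"
    by (rule cochain_eval_superset[symmetric]) auto
  finally show ?thesis .
qed

lemma cochain_eval_sum: "cochain_eval \<kappa> (sum f A) = (\<Sum>a\<in>A. cochain_eval \<kappa> (f a))"
  by (induction A rule: infinite_finite_induct) (simp_all add: cochain_eval_add)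

lemma cochain_eval_smult:
  "cochain_eval \<kappa> (r \<odot>\<^bsub>bar_chains G n\<^esub> z) = r * cochain_eval \<kappa> z"
proof -
  have "cochain_eval \<kappa> (r \<odot>\<^bsub>bar_chains G n\<^esub> z) = (\<Sum>gs\<in>Poly_Mapping.keys z.
      Poly_Mapping.lookup (r \<odot>\<^bsub>bar_chains G n\<^esub> z) gs * \<kappa> gs)"
    by (rule cochain_eval_superset) (auto dest: subsetD[OF keys_smult_bar_chains])
  then show ?thesis
    by (simp add: lookup_smult_bar_chains cochain_eval_def sum_distrib_left mult.assoc)
qed

definition cocycle_coeff :: "('a \<Rightarrow> 'a \<Rightarrow> 'j \<Rightarrow>\<^sub>0 rat) \<Rightarrow> 'j \<Rightarrow> 'a list \<Rightarrow> rat" where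
  "cocycle_coeff c j gs = Poly_Mapping.lookup (c (gs ! 0) (gs ! 1)) j"

lemma cocycle_coeff_pair [simp]: "cocycle_coeff c j [f, g] = Poly_Mapping.lookup (c f g) j"
  by (simp add: cocycle_coeff_def)

text \<open>
  On \<open>[f, g, h]\<close> the four faces contribute the two sides of the cocycle equation with opposite
  signs, so a cocycle induces a functional on second homology.
\<close>

lemma cochain_eval_boundary:
  assumes c: "two_cocycle G c" and z: "z \<in> bar_boundaries G 2"
  shows "cochain_eval (cocycle_coeff c j) z = 0"
proof -
  obtain b where b: "b \<in> carrier (bar_chains G 3)" "z = bar_boundary G 3 b"
    using z by (auto simp: bar_boundaries_def eval_nat_numeral)
  have "(\<Sum>i\<le>3. (- 1) ^ i * Poly_Mapping.lookup b gs * cocycle_coeff c j (bar_face G i gs)) = 0"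
    if gs: "gs \<in> Poly_Mapping.keys b" for gs
  proof -
    have "length gs = 3" "set gs \<subseteq> carrier G"
      using b(1) gs by (auto simp: bar_chains_simps)
    then obtain f g h where gs: "gs = [f, g, h]" "f \<in> carrier G" "g \<in> carrier G" "h \<in> carrier G"
      by (auto simp: eval_nat_numeral length_Suc_conv)
    have "c g h + c f (g \<otimes>\<^bsub>G\<^esub> h) = c (f \<otimes>\<^bsub>G\<^esub> g) h + c f g"
      using c gs by (simp add: two_cocycle_def)
    then have "Poly_Mapping.lookup b gs * Poly_Mapping.lookup (c g h + c f (g \<otimes>\<^bsub>G\<^esub> h)) j =
        Poly_Mapping.lookup b gs * Poly_Mapping.lookup (c (f \<otimes>\<^bsub>G\<^esub> g) h + c f g) j"
      by (rule arg_cong)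
    then show ?thesis
      by (simp add: gs(1) bar_face_def eval_nat_numeral lookup_add algebra_simps)
  qed
  then show ?thesis
    unfolding b(2) bar_boundary_def by (simp add: cochain_eval_sum)
qed

text \<open>
  The image of the fundamental class of a torus: commuting elements define a homomorphism from
  \<open>\<int> \<times> \<int>\<close>.
\<close>

lemma (in group) commuting_cycle:
  assumes "f \<in> carrier G" "g \<in> carrier G" "f \<otimes> g = g \<otimes> f"
  shows "Poly_Mapping.single [f, g] 1 - Poly_Mapping.single [g, f] 1 \<in> bar_cycles G 2"
proof -
  let ?z = "Poly_Mapping.single [f, g] (1::rat) + Poly_Mapping.single [g, f] (- 1)"
  have "?z \<in> carrier (bar_chains G 2)"
    using assms keys_add[of "Poly_Mapping.single [f, g] (1::rat)" "Poly_Mapping.single [g, f] (- 1)"]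
    by (auto simp: bar_chains_simps split: if_splits)
  moreover have "bar_boundary G 2 ?z = 0"
    unfolding bar_boundary_add using assms(3)
    by (simp add: bar_boundary_single bar_face_def eval_nat_numeral del: single_uminus)
      (simp add: single_uminus)
  ultimately show ?thesis
    by (simp add: bar_cycles_def single_uminus)
qed

text \<open>
  Coefficientwise evaluation of \<open>c\<close> is a linear map from second homology to finitely supported
  functions. If finitely many classes span, then the supports of their finitely many values
  contain the support of every value, in particular of the value \<open>c f g - c g f\<close> on the torus
  class of a commuting pair.
\<close>

lemma (in group) commuting_support_finite_if_H2_fin_dim:
  fixes c :: "'a \<Rightarrow> 'a \<Rightarrow> 'j \<Rightarrow>\<^sub>0 rat"
  assumes c: "two_cocycle G c"
    and fin: "vectorspace.fin_dim class_ring (group_homology G 2)"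
  obtains J where "finite J"
    "\<And>f g. f \<in> carrier G \<Longrightarrow> g \<in> carrier G \<Longrightarrow> f \<otimes> g = g \<otimes> f \<Longrightarrow>
       Poly_Mapping.keys (c f g - c g f) \<subseteq> J"
proof -
  let ?H = "group_homology G 2" and ?B = "bar_boundaries G 2"
  let ?M = "bar_chains G 2\<lparr>carrier := bar_cycles G 2\<rparr>"
  let ?ev = "\<lambda>j. cochain_eval (cocycle_coeff c j)"
  interpret H: vectorspace class_ring ?H by (rule vectorspace_group_homology)
  interpret B: LinearCombinations.submodule class_ring ?B ?M by (rule submodule_bar_boundaries)
  interpret M: Module.module class_ring ?M by (rule B.module)
  obtain A where A: "finite A" "A \<subseteq> carrier ?H" "H.span A = carrier ?H"
    using fin by (auto simp: H.fin_dim_def)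
  have coset: "?B +>\<^bsub>?M\<^esub> v = {b + v | b. b \<in> ?B}" for v
    by (auto simp: a_r_coset_def' bar_chains_simps)
  have carrier: "carrier ?H = (\<lambda>v. ?B +>\<^bsub>?M\<^esub> v) ` bar_cycles G 2"
    by (auto simp: group_homology_def quotient_module_def A_RCOSETS_def')
  have ev_coset: "?ev j z = ?ev j v" if "z \<in> ?B +>\<^bsub>?M\<^esub> v" for j z v
    using that by (auto simp: coset cochain_eval_add cochain_eval_boundary[OF c])
  \<comment> \<open>Evaluation is constant on classes, and each value has finitely many non-zero coefficients.\<close>
  have "\<exists>J. finite J \<and> (\<forall>z\<in>C. \<forall>j. j \<notin> J \<longrightarrow> ?ev j z = 0)" if C: "C \<in> carrier ?H" for C
  proof -
    obtain v where v: "C = ?B +>\<^bsub>?M\<^esub> v"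
      using C unfolding carrier by blast
    let ?J = "\<Union>gs\<in>Poly_Mapping.keys v. Poly_Mapping.keys (c (gs ! 0) (gs ! 1))"
    have "?ev j v = 0" if "j \<notin> ?J" for j
      unfolding cochain_eval_def using that
      by (intro sum.neutral) (auto simp: in_keys_iff cocycle_coeff_def)
    then show ?thesis
      using ev_coset unfolding v by (intro exI[of _ ?J]) auto
  qed
  then obtain supp where supp: "\<And>C. C \<in> carrier ?H \<Longrightarrow> finite (supp C)"
      "\<And>C z j. C \<in> carrier ?H \<Longrightarrow> z \<in> C \<Longrightarrow> j \<notin> supp C \<Longrightarrow> ?ev j z = 0"
    by metis
  define J where "J = (\<Union>C\<in>A. supp C)"
  define W where "W = {C \<in> carrier ?H. \<forall>z\<in>C. \<forall>j. j \<notin> J \<longrightarrow> ?ev j z = 0}"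
  have "LinearCombinations.submodule class_ring W ?H"
  proof (rule LinearCombinations.submodule.intro)
    show "Module.module class_ring ?H" ..
    show "W \<subseteq> carrier ?H"
      by (auto simp: W_def)
    show "\<zero>\<^bsub>?H\<^esub> \<in> W"
      using cochain_eval_boundary[OF c] H.M.zero_closed
      by (auto simp: W_def group_homology_def quotient_module_def)
  next
    fix C D assume CD: "C \<in> W" "D \<in> W"
    then have "C \<oplus>\<^bsub>?H\<^esub> D \<in> carrier ?H"
      by (auto simp: W_def)
    moreover have "C \<oplus>\<^bsub>?H\<^esub> D = {x + y | x y. x \<in> C \<and> y \<in> D}"
      by (auto simp: group_homology_def quotient_module_def set_add_def' bar_chains_simps)
    ultimately show "C \<oplus>\<^bsub>?H\<^esub> D \<in> W"
      using CD by (auto simp: W_def cochain_eval_add)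
  next
    fix r :: rat and C assume r: "r \<in> carrier class_ring" and C: "C \<in> W"
    then have "r \<odot>\<^bsub>?H\<^esub> C \<in> carrier ?H"
      by (auto simp: W_def)
    moreover have "r \<odot>\<^bsub>?H\<^esub> C = (\<Union>v\<in>C. ?B +>\<^bsub>?M\<^esub> (r \<odot>\<^bsub>bar_chains G 2\<^esub> v))"
      by (simp add: group_homology_def quotient_module_def)
    ultimately show "r \<odot>\<^bsub>?H\<^esub> C \<in> W"
      using C ev_coset[of _ "r \<odot>\<^bsub>bar_chains G 2\<^esub> _"]
      by (fastforce simp: W_def cochain_eval_smult)
  qed
  moreover have "A \<subseteq> W"
    using A(2) supp(2) by (auto simp: W_def J_def)
  ultimately have "H.span A \<subseteq> W"
    by (intro H.span_is_subset)
  then have W: "carrier ?H \<subseteq> W"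
    using A(3) by simp
  show thesis
  proof (rule that[of J])
    show "finite J"
      using A supp(1) by (auto simp: J_def)
    fix f g assume fg: "f \<in> carrier G" "g \<in> carrier G" "f \<otimes> g = g \<otimes> f"
    let ?z = "Poly_Mapping.single [f, g] 1 - Poly_Mapping.single [g, f] (1::rat)"
    have "?B +>\<^bsub>?M\<^esub> ?z \<in> W"
      using W commuting_cycle[OF fg] by (auto simp: carrier)
    moreover have "?z \<in> ?B +>\<^bsub>?M\<^esub> ?z"
      using B.zero_closed by (auto simp: coset bar_chains_simps intro!: exI[of _ 0])
    ultimately have "?ev j ?z = 0" if "j \<notin> J" for j
      using that by (auto simp: W_def)
    moreover have "?ev j ?z = Poly_Mapping.lookup (c f g - c g f) j" for j
      using cochain_eval_add[of "cocycle_coeff c j" ?z "Poly_Mapping.single [g, f] 1"] by (simp add: lookup_minus)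
    ultimately show "Poly_Mapping.keys (c f g - c g f) \<subseteq> J"
      by (auto simp: in_keys_iff)
  qed
qed

text \<open>
  A cocycle can have a non-zero value at \<open>(\<one>, \<one>)\<close>; hence the correction term in the neutral element.
\<close>

definition cocycle_extension ::
    "('a, 'm) monoid_scheme \<Rightarrow> ('a \<Rightarrow> 'a \<Rightarrow> 'b::ab_group_add) \<Rightarrow> ('b \<times> 'a) monoid" where
  "cocycle_extension G c =
     \<lparr>carrier = UNIV \<times> carrier G,
      mult = (\<lambda>(a, g) (b, h). (a + b + c g h, g \<otimes>\<^bsub>G\<^esub> h)),
      one = (- c \<one>\<^bsub>G\<^esub> \<one>\<^bsub>G\<^esub>, \<one>\<^bsub>G\<^esub>)\<rparr>"

lemma (in group) two_cocycle_one:
  assumes "two_cocycle G c" "g \<in> carrier G"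
  shows "c \<one> g = c \<one> \<one>" "c g \<one> = c \<one> \<one>"
  using assms(1)[unfolded two_cocycle_def, rule_format, of \<one> \<one> g]
    assms(1)[unfolded two_cocycle_def, rule_format, of g \<one> \<one>] assms(2)
  by simp_all

lemma (in group) group_cocycle_extension:
  assumes c: "two_cocycle G c"
  shows "group (cocycle_extension G c)"
proof (rule groupI)
  fix x y z
  assume "x \<in> carrier (cocycle_extension G c)" "y \<in> carrier (cocycle_extension G c)"
    "z \<in> carrier (cocycle_extension G c)"
  then obtain a f b g d h where *: "x = (a, f)" "y = (b, g)" "z = (d, h)"
      "f \<in> carrier G" "g \<in> carrier G" "h \<in> carrier G"
    by (auto simp: cocycle_extension_def)
  then have "c g h + c f (g \<otimes> h) = c (f \<otimes> g) h + c f g"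
    using c by (simp add: two_cocycle_def)
  then show "x \<otimes>\<^bsub>cocycle_extension G c\<^esub> y \<otimes>\<^bsub>cocycle_extension G c\<^esub> z =
      x \<otimes>\<^bsub>cocycle_extension G c\<^esub> (y \<otimes>\<^bsub>cocycle_extension G c\<^esub> z)"
    using * by (simp add: cocycle_extension_def m_assoc algebra_simps)
next
  fix x assume "x \<in> carrier (cocycle_extension G c)"
  then obtain a f where *: "x = (a, f)" "f \<in> carrier G"
    by (auto simp: cocycle_extension_def)
  then show "\<exists>y\<in>carrier (cocycle_extension G c).
      y \<otimes>\<^bsub>cocycle_extension G c\<^esub> x = \<one>\<^bsub>cocycle_extension G c\<^esub>"
    by (intro bexI[of _ "(- c \<one> \<one> - a - c (inv f) f, inv f)"]) (simp_all add: cocycle_extension_def)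
  show "\<one>\<^bsub>cocycle_extension G c\<^esub> \<otimes>\<^bsub>cocycle_extension G c\<^esub> x = x"
    using * two_cocycle_one[OF c *(2)] by (simp add: cocycle_extension_def)
qed (auto simp: cocycle_extension_def)

text \<open>
  It is more convenient to have a presentation as an epimorphism from a free group than as an
  isomorphism with a quotient.
\<close>

lemma presentation_kernel:
  assumes G: "group G" and R: "R \<subseteq> carrier (free_group S)"
    and iso: "G \<cong> presented_group S R"
  obtains \<theta> where "\<theta> \<in> hom (free_group S) G" "\<theta> ` carrier (free_group S) = carrier G"
    "kernel (free_group S) G \<theta> = normal_closure (free_group S) R"
proof -
  let ?F = "free_group S" and ?N = "normal_closure (free_group S) R"
  interpret G: group G by (rule G)
  interpret F: group ?F by (rule group_free_group)
  interpret N: normal ?N ?F by (rule F.normal_closure_normal[OF R])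
  interpret Q: group "?F Mod ?N" by (rule N.factorgroup_is_group)
  obtain h where h: "h \<in> iso G (?F Mod ?N)"
    using iso by (auto simp: is_iso_def presented_group_def)
  define \<psi> where "\<psi> = inv_into (carrier G) h"
  have \<psi>: "\<psi> \<in> iso (?F Mod ?N) G"
    unfolding \<psi>_def by (rule G.iso_set_sym[OF h])
  interpret \<psi>: group_hom "?F Mod ?N" G \<psi>
    using \<psi> by (simp add: group_hom_def group_hom_axioms_def iso_def G Q.is_group)
  define \<theta> where "\<theta> = \<psi> \<circ> (\<lambda>w. ?N #>\<^bsub>?F\<^esub> w)"
  have coset: "?N #>\<^bsub>?F\<^esub> w \<in> carrier (?F Mod ?N)" if "w \<in> carrier ?F" for w
    using that by (auto simp: FactGroup_def RCOSETS_def)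
  show thesis
  proof (rule that[of \<theta>])
    show "\<theta> \<in> hom ?F G"
      unfolding \<theta>_def by (rule Group.hom_compose[OF N.r_coset_hom_Mod \<psi>.homh])
    have "(\<lambda>w. ?N #>\<^bsub>?F\<^esub> w) ` carrier ?F = carrier (?F Mod ?N)"
      by (auto simp: FactGroup_def RCOSETS_def)
    moreover have "\<psi> ` carrier (?F Mod ?N) = carrier G"
      using \<psi> by (simp add: iso_def bij_betw_def)
    ultimately show "\<theta> ` carrier ?F = carrier G"
      by (simp add: \<theta>_def flip: image_image image_comp)
    have "\<psi> C = \<one>\<^bsub>G\<^esub> \<longleftrightarrow> C = \<one>\<^bsub>?F Mod ?N\<^esub>" if "C \<in> carrier (?F Mod ?N)" for C
      using \<psi> that \<psi>.hom_one by (auto simp: \<psi>.iso_iff simp del: \<psi>.hom_one)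
    moreover have "?N #>\<^bsub>?F\<^esub> w = ?N \<longleftrightarrow> w \<in> ?N" if "w \<in> carrier ?F" for w
      using that F.coset_join1[OF _ that N.is_subgroup] N.rcos_const[OF F.is_group] by blast
    ultimately show "kernel ?F G \<theta> = ?N"
      using coset N.subset by (auto simp: kernel_def \<theta>_def)
  qed
qed

lemma (in group_hom) normal_preimage:
  assumes "N \<lhd> H"
  shows "{x \<in> carrier G. h x \<in> N} \<lhd> G"
proof -
  interpret N: normal N H by (rule assms)
  have "subgroup {x \<in> carrier G. h x \<in> N} G"
    by (rule G.subgroupI) (use N.one_closed in \<open>auto simp del: N.one_closed\<close>)
  then show ?thesis
    by (auto simp: G.normal_inv_iff N.inv_op_closed2)
qed

text \<open>
  The epimorphism from the free group lifts to the central extension defined by \<open>c\<close>. Each relator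
  is sent to the centre, so the finitely many relators have central coordinates supported in a
  common finite set, and this remains true for their normal closure. If \<open>u\<close> and \<open>v\<close> lift the
  commuting elements \<open>f\<close> and \<open>g\<close>, then the commutator of \<open>u\<close> and \<open>v\<close> lies in this normal closure,
  and its central coordinate is \<open>c f g - c g f\<close>.
\<close>

lemma (in group) commuting_support_finite_if_finitely_presentable:
  fixes c :: "'a \<Rightarrow> 'a \<Rightarrow> 'j \<Rightarrow>\<^sub>0 rat"
  assumes c: "two_cocycle G c" and fp: "finitely_presentable G"
  obtains J where "finite J"
    "\<And>f g. f \<in> carrier G \<Longrightarrow> g \<in> carrier G \<Longrightarrow> f \<otimes> g = g \<otimes> f \<Longrightarrow>
       Poly_Mapping.keys (c f g - c g f) \<subseteq> J"
proof -
  obtain m :: nat and R where R: "finite R" "R \<subseteq> carrier (free_group {..<m})"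
      and iso: "G \<cong> presented_group {..<m} R"
    using fp by (auto simp: finitely_presentable_def)
  let ?F = "free_group {..<m}" and ?E = "cocycle_extension G c"
  obtain \<theta> where \<theta>: "\<theta> \<in> hom ?F G" "\<theta> ` carrier ?F = carrier G"
      "kernel ?F G \<theta> = normal_closure ?F R"
    by (rule presentation_kernel[OF is_group R(2) iso])
  interpret F: group ?F by (rule group_free_group)
  interpret E: group ?E by (rule group_cocycle_extension[OF c])
  interpret \<theta>: group_hom ?F G \<theta>
    using \<theta>(1) by (simp add: group_hom_def group_hom_axioms_def F.is_group is_group)
  define \<Lambda> where "\<Lambda> = free_lift ?E (\<lambda>a. (0, \<theta> (gen a)))"
  have gens: "(\<lambda>a. (0, \<theta> (gen a))) \<in> {..<m} \<rightarrow> carrier ?E"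
    by (auto simp: cocycle_extension_def)
  interpret \<Lambda>: group_hom ?F ?E \<Lambda>
    unfolding \<Lambda>_def by (rule free_lift_group_hom[OF E.is_group gens])
  have "snd \<in> hom ?E G"
    by (rule homI) (auto simp: cocycle_extension_def)
  then have "(snd \<circ> \<Lambda>) w = \<theta> w" if "w \<in> carrier ?F" for w
    by (rule free_group_hom_eqI[OF is_group Group.hom_compose[OF \<Lambda>.homh] \<theta>(1) _ that])
      (simp add: \<Lambda>_def free_lift_gen[OF E.is_group gens])
  then have snd_\<Lambda>: "snd (\<Lambda> w) = \<theta> w" if "w \<in> carrier ?F" for w
    using that by simp
  define J where "J = (\<Union>r\<in>R. Poly_Mapping.keys (fst (\<Lambda> r) + c \<one> \<one>))"
  \<comment> \<open>The element \<open>(a - c \<one> \<one>, \<one>)\<close> is the image of \<open>a\<close> under the embedding of the kernel.\<close>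
  define Z where "Z = {(a - c \<one> \<one>, \<one>) | a. Poly_Mapping.keys a \<subseteq> J}"
  have Z_mult: "(a - c \<one> \<one>, \<one>) \<otimes>\<^bsub>?E\<^esub> (b, g) = (a + b, g)"
    "(b, g) \<otimes>\<^bsub>?E\<^esub> (a - c \<one> \<one>, \<one>) = (a + b, g)" if "g \<in> carrier G" for a b g
    using that two_cocycle_one[OF c that] by (simp_all add: cocycle_extension_def)
  have Z: "Z \<lhd> ?E"
    unfolding E.normal_inv_iff
  proof (intro conjI ballI)
    show "subgroup Z ?E"
    proof (rule E.subgroupI)
      show "Z \<subseteq> carrier ?E"
        by (auto simp: Z_def cocycle_extension_def)
      have "(0 - c \<one> \<one>, \<one>) \<in> Z"
        unfolding Z_def by (intro CollectI exI[of _ 0]) simp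
      then show "Z \<noteq> {}" by blast
    next
      fix x assume "x \<in> Z"
      then obtain a where a: "x = (a - c \<one> \<one>, \<one>)" "Poly_Mapping.keys a \<subseteq> J"
        by (auto simp: Z_def)
      have "inv\<^bsub>?E\<^esub> x = (- a - c \<one> \<one>, \<one>)"
      proof (rule E.inv_equality)
        show "(- a - c \<one> \<one>, \<one>) \<otimes>\<^bsub>?E\<^esub> x = \<one>\<^bsub>?E\<^esub>"
          unfolding a(1) Z_mult(1)[OF one_closed] by (simp add: cocycle_extension_def)
      qed (auto simp: a(1) cocycle_extension_def)
      then show "inv\<^bsub>?E\<^esub> x \<in> Z"
        using a(2) by (auto simp: Z_def intro!: exI[of _ "- a"])
    next
      fix x y assume "x \<in> Z" "y \<in> Z"
      then obtain a b where *: "x = (a - c \<one> \<one>, \<one>)" "Poly_Mapping.keys a \<subseteq> J"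
          "y = (b - c \<one> \<one>, \<one>)" "Poly_Mapping.keys b \<subseteq> J"
        by (auto simp: Z_def)
      moreover have "x \<otimes>\<^bsub>?E\<^esub> y = ((a + b) - c \<one> \<one>, \<one>)"
        unfolding *(1,3) Z_mult(1)[OF one_closed] by simp
      ultimately show "x \<otimes>\<^bsub>?E\<^esub> y \<in> Z"
        using keys_add[of a b] unfolding Z_def by blast
    qed
  next
    fix x z assume x: "x \<in> carrier ?E" and z: "z \<in> Z"
    then have zE: "z \<in> carrier ?E"
      by (auto simp: Z_def cocycle_extension_def)
    have cE: "carrier ?E = UNIV \<times> carrier G"
      by (simp add: cocycle_extension_def)
    have "x \<otimes>\<^bsub>?E\<^esub> z = z \<otimes>\<^bsub>?E\<^esub> x"
      using x z cE by (cases x) (auto simp: Z_def Z_mult)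
    then have "x \<otimes>\<^bsub>?E\<^esub> z \<otimes>\<^bsub>?E\<^esub> inv\<^bsub>?E\<^esub> x = z"
      using x zE by (simp add: E.m_assoc)
    then show "x \<otimes>\<^bsub>?E\<^esub> z \<otimes>\<^bsub>?E\<^esub> inv\<^bsub>?E\<^esub> x \<in> Z"
      using z by simp
  qed
  \<comment> \<open>The relators, hence all words that are trivial in \<open>G\<close>, lift into the central subgroup \<open>Z\<close>.\<close>
  have "R \<subseteq> {w \<in> carrier ?F. \<Lambda> w \<in> Z}"
  proof
    fix r assume r: "r \<in> R"
    then have "r \<in> kernel ?F G \<theta>"
      unfolding \<theta>(3) normal_closure_def by (rule subsetD[OF hull_subset])
    then have "\<Lambda> r = ((fst (\<Lambda> r) + c \<one> \<one>) - c \<one> \<one>, \<one>)"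
      using snd_\<Lambda>[of r] by (simp add: kernel_def prod_eq_iff)
    moreover have "Poly_Mapping.keys (fst (\<Lambda> r) + c \<one> \<one>) \<subseteq> J"
      using r by (auto simp: J_def)
    ultimately show "r \<in> {w \<in> carrier ?F. \<Lambda> w \<in> Z}"
      using r R(2) unfolding Z_def by blast
  qed
  then have ker: "kernel ?F G \<theta> \<subseteq> {w \<in> carrier ?F. \<Lambda> w \<in> Z}"
    unfolding \<theta>(3) normal_closure_def by (rule hull_minimal) (rule \<Lambda>.normal_preimage[OF Z])
  show thesis
  proof (rule that[of J])
    show "finite J"
      using R(1) by (simp add: J_def)
    fix f g assume fg: "f \<in> carrier G" "g \<in> carrier G" "f \<otimes> g = g \<otimes> f"
    then obtain u v where uv: "u \<in> carrier ?F" "v \<in> carrier ?F" "f = \<theta> u" "g = \<theta> v"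
      using \<theta>(2) by blast
    let ?w = "(u \<otimes>\<^bsub>?F\<^esub> v) \<otimes>\<^bsub>?F\<^esub> inv\<^bsub>?F\<^esub> (v \<otimes>\<^bsub>?F\<^esub> u)"
    have "?w \<in> kernel ?F G \<theta>"
      using uv fg by (simp add: kernel_def del: F.inv_mult_group)
    then obtain a where a: "\<Lambda> ?w = (a - c \<one> \<one>, \<one>)" "Poly_Mapping.keys a \<subseteq> J"
      using ker by (auto simp: Z_def)
    have "?w \<otimes>\<^bsub>?F\<^esub> (v \<otimes>\<^bsub>?F\<^esub> u) = u \<otimes>\<^bsub>?F\<^esub> v"
      using uv by (simp add: F.m_assoc del: F.inv_mult_group)
    then have "\<Lambda> ?w \<otimes>\<^bsub>?E\<^esub> \<Lambda> (v \<otimes>\<^bsub>?F\<^esub> u) = \<Lambda> (u \<otimes>\<^bsub>?F\<^esub> v)"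
      using uv by (metis F.inv_closed F.m_closed \<Lambda>.hom_mult)
    moreover have "\<Lambda> (p \<otimes>\<^bsub>?F\<^esub> q) = (fst (\<Lambda> p) + fst (\<Lambda> q) + c (\<theta> p) (\<theta> q), \<theta> p \<otimes> \<theta> q)"
      if "p \<in> carrier ?F" "q \<in> carrier ?F" for p q
      using that snd_\<Lambda>[of p] snd_\<Lambda>[of q]
      by (cases "\<Lambda> p"; cases "\<Lambda> q") (simp add: cocycle_extension_def)
    ultimately have "c f g - c g f = a"
      using uv fg by (simp add: a(1) Z_mult algebra_simps)
    then show "Poly_Mapping.keys (c f g - c g f) \<subseteq> J"
      using a(2) by simp
  qed
qed


section \<open>Transvections of free groups\<close>

text \<open>
  The endomorphism that sends the generator \<open>a\<close> to \<open>u a v\<close> and fixes the other generators. It is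
  an automorphism when \<open>a\<close> does not occur in \<open>u\<close> and \<open>v\<close>.
\<close>

definition transvection :: "'a set \<Rightarrow> 'a \<Rightarrow> 'a word \<Rightarrow> 'a word \<Rightarrow> 'a word \<Rightarrow> 'a word" where
  "transvection S a u v =
     restrict (free_lift (free_group S)
       (gen(a := u \<otimes>\<^bsub>free_group S\<^esub> gen a \<otimes>\<^bsub>free_group S\<^esub> v))) (carrier (free_group S))"

lemma free_group_mono: "S \<subseteq> T \<Longrightarrow> carrier (free_group S) \<subseteq> carrier (free_group T)"
  unfolding carrier_free_group subset_iff by blast

lemma id_hom_free_group: "S \<subseteq> T \<Longrightarrow> (\<lambda>w. w) \<in> hom (free_group S) (free_group T)"
  using free_group_mono[of S T] by (auto simp: hom_def free_group_simps)

context
  fixes S :: "'a set" and a :: 'a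
  assumes a: "a \<in> S"
begin

private abbreviation "\<F> \<equiv> free_group S"
private abbreviation "\<F>' \<equiv> free_group (S - {a})"
private abbreviation "\<tau> \<equiv> transvection S a"

interpretation F: group "free_group S"
  by (rule group_free_group)

interpretation F': group "free_group (S - {a})"
  by (rule group_free_group)

lemma free_group_remove_closed: "u \<in> carrier \<F>' \<Longrightarrow> u \<in> carrier \<F>"
  using free_group_mono[of "S - {a}" S] by blast

lemma
  assumes u: "u \<in> carrier \<F>'" and v: "v \<in> carrier \<F>'"
  shows transvection_hom: "\<tau> u v \<in> hom \<F> \<F>"
    and transvection_gen: "\<tau> u v (gen a) = u \<otimes>\<^bsub>\<F>\<^esub> gen a \<otimes>\<^bsub>\<F>\<^esub> v"
    and transvection_gen_other: "b \<in> S \<Longrightarrow> b \<noteq> a \<Longrightarrow> \<tau> u v (gen b) = gen b"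
    and transvection_fixes: "w \<in> carrier \<F>' \<Longrightarrow> \<tau> u v w = w"
proof -
  let ?h = "gen(a := u \<otimes>\<^bsub>\<F>\<^esub> gen a \<otimes>\<^bsub>\<F>\<^esub> v)"
  have h: "?h \<in> S \<rightarrow> carrier \<F>"
    using a u v free_group_remove_closed by auto
  show hom: "\<tau> u v \<in> hom \<F> \<F>"
    by (rule F.hom_eq[OF free_lift_hom[OF F.is_group h]]) (simp add: transvection_def)
  show "\<tau> u v (gen a) = u \<otimes>\<^bsub>\<F>\<^esub> gen a \<otimes>\<^bsub>\<F>\<^esub> v"
    using a by (simp add: transvection_def free_lift_gen[OF F.is_group h])
  show other: "\<tau> u v (gen b) = gen b" if "b \<in> S" "b \<noteq> a" for b
    using that by (simp add: transvection_def free_lift_gen[OF F.is_group h])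
  show "\<tau> u v w = w" if "w \<in> carrier \<F>'"
  proof (rule free_group_hom_eqI[OF F.is_group _ _ _ that])
    show "\<tau> u v \<in> hom \<F>' \<F>"
      using Group.hom_compose[OF id_hom_free_group hom, of "S - {a}"] by (simp add: comp_def)
    show "(\<lambda>w. w) \<in> hom \<F>' \<F>"
      by (rule id_hom_free_group) blast
  qed (auto intro: other)
qed

text \<open>
  The inner words are fixed by the outer transvection. In particular left and right
  transvections commute, and inverting \<open>u\<close> and \<open>v\<close> inverts the transvection.
\<close>

lemma transvection_transvection:
  assumes "u \<in> carrier \<F>'" "v \<in> carrier \<F>'" "u' \<in> carrier \<F>'" "v' \<in> carrier \<F>'"
    and w: "w \<in> carrier \<F>"
  shows "\<tau> u v (\<tau> u' v' w) = \<tau> (u' \<otimes>\<^bsub>\<F>\<^esub> u) (v \<otimes>\<^bsub>\<F>\<^esub> v') w"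
proof -
  have F'_mult: "p \<otimes>\<^bsub>\<F>\<^esub> q \<in> carrier \<F>'" if "p \<in> carrier \<F>'" "q \<in> carrier \<F>'" for p q
    using F'.m_closed[OF that] by (simp add: free_group_simps)
  interpret \<tau>: group_hom \<F> \<F> "\<tau> u v"
    using transvection_hom[OF assms(1,2)]
    by (simp add: group_hom_def group_hom_axioms_def F.is_group)
  have "(\<tau> u v \<circ> \<tau> u' v') w = \<tau> (u' \<otimes>\<^bsub>\<F>\<^esub> u) (v \<otimes>\<^bsub>\<F>\<^esub> v') w"
  proof (rule free_group_hom_eqI[OF F.is_group _ _ _ w])
    show "\<tau> u v \<circ> \<tau> u' v' \<in> hom \<F> \<F>"
      by (rule Group.hom_compose) (use assms in \<open>auto intro!: transvection_hom\<close>)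
    show "\<tau> (u' \<otimes>\<^bsub>\<F>\<^esub> u) (v \<otimes>\<^bsub>\<F>\<^esub> v') \<in> hom \<F> \<F>"
      using assms by (auto intro!: transvection_hom F'_mult)
    fix b assume b: "b \<in> S"
    show "(\<tau> u v \<circ> \<tau> u' v') (gen b) = \<tau> (u' \<otimes>\<^bsub>\<F>\<^esub> u) (v \<otimes>\<^bsub>\<F>\<^esub> v') (gen b)"
    proof (cases "b = a")
      case True
      then show ?thesis
        using assms a
        by (simp add: transvection_gen F'_mult free_group_remove_closed transvection_fixes F.m_assoc)
    next
      case False
      then show ?thesis
        using assms b by (simp add: transvection_gen_other F'_mult)
    qed
  qed
  then show ?thesis by simp
qed

lemma transvection_one: "w \<in> carrier \<F> \<Longrightarrow> \<tau> \<one>\<^bsub>\<F>\<^esub> \<one>\<^bsub>\<F>\<^esub> w = w"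
proof (rule free_group_hom_eqI[OF F.is_group])
  have one: "\<one>\<^bsub>\<F>\<^esub> \<in> carrier \<F>'"
    using F'.one_closed by (simp add: free_group_simps)
  show "\<tau> \<one>\<^bsub>\<F>\<^esub> \<one>\<^bsub>\<F>\<^esub> \<in> hom \<F> \<F>"
    by (rule transvection_hom[OF one one])
  fix b assume b: "b \<in> S"
  then show "\<tau> \<one>\<^bsub>\<F>\<^esub> \<one>\<^bsub>\<F>\<^esub> (gen b) = gen b"
    by (cases "b = a") (simp_all add: transvection_gen[OF one one] transvection_gen_other[OF one one])
qed (simp_all add: id_hom_free_group)

lemma transvection_auto:
  assumes u: "u \<in> carrier \<F>'" and v: "v \<in> carrier \<F>'"
  shows "\<tau> u v \<in> auto \<F>"
proof -
  let ?u' = "inv\<^bsub>\<F>'\<^esub> u" and ?v' = "inv\<^bsub>\<F>'\<^esub> v"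
  have inv: "?u' \<otimes>\<^bsub>\<F>\<^esub> u = \<one>\<^bsub>\<F>\<^esub>" "v \<otimes>\<^bsub>\<F>\<^esub> ?v' = \<one>\<^bsub>\<F>\<^esub>" "u \<otimes>\<^bsub>\<F>\<^esub> ?u' = \<one>\<^bsub>\<F>\<^esub>" "?v' \<otimes>\<^bsub>\<F>\<^esub> v = \<one>\<^bsub>\<F>\<^esub>"
    using F'.l_inv[OF u] F'.r_inv[OF u] F'.l_inv[OF v] F'.r_inv[OF v]
    by (simp_all add: free_group_simps)
  have "bij_betw (\<tau> u v) (carrier \<F>) (carrier \<F>)"
    by (rule bij_betw_byWitness[where f' = "\<tau> ?u' ?v'"])
      (use u v transvection_hom[OF u v] transvection_hom[of ?u' ?v'] in
        \<open>auto simp: transvection_transvection inv transvection_one hom_def\<close>)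
  then show ?thesis
    using transvection_hom[OF u v] by (auto simp: auto_iff transvection_def)
qed

lemma hom_transvection_eq:
  assumes "group G" "q \<in> hom \<F> G"
    and u: "u \<in> carrier \<F>'" "q u = \<one>\<^bsub>G\<^esub>" and v: "v \<in> carrier \<F>'" "q v = \<one>\<^bsub>G\<^esub>"
    and w: "w \<in> carrier \<F>"
  shows "q (\<tau> u v w) = q w"
proof -
  interpret q: group_hom \<F> G q
    using assms(1,2) by (simp add: group_hom_def group_hom_axioms_def F.is_group)
  have "(q \<circ> \<tau> u v) w = q w"
  proof (rule free_group_hom_eqI[OF assms(1) _ assms(2) _ w])
    show "q \<circ> \<tau> u v \<in> hom \<F> G"
      by (rule Group.hom_compose[OF transvection_hom[OF u(1) v(1)] assms(2)])
    fix b assume "b \<in> S"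
    then show "(q \<circ> \<tau> u v) (gen b) = q (gen b)"
      using a u v
      by (cases "b = a") (simp_all add: transvection_gen transvection_gen_other free_group_remove_closed)
  qed
  then show ?thesis by simp
qed

end

section \<open>Fox calculus\<close>

type_synonym laurent = "int \<Rightarrow>\<^sub>0 rat"

text \<open>
  The group ring of \<open>\<int>\<close> over \<open>\<rat>\<close> is the ring of Laurent polynomials, and \<open>T i\<close> is the \<open>i\<close>-th power
  of the variable.
\<close>

definition T :: "int \<Rightarrow> laurent" where
  "T i = Poly_Mapping.single i 1"

lemma T_add: "T (i + j) = T i * T j"
  by (simp add: T_def mult_single)

lemma T_0 [simp]: "T 0 = 1"
  by (simp add: T_def)

lemma T_inverse [simp]: "T i * T (- i) = 1" "T (- i) * T i = 1"
  "T i * (T (- i) * p) = p" "T (- i) * (T i * p) = p"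
  by (simp_all flip: T_add mult.assoc)

lemma lookup_T: "Poly_Mapping.lookup (T i) j = (if i = j then 1 else 0)"
  by (simp add: T_def lookup_single when_def)

lemma T_inject [simp]: "T i = T j \<longleftrightarrow> i = j"
  using lookup_T[of i i] lookup_T[of j i] by (auto split: if_splits)

text \<open>
  The semidirect product of two copies of the Laurent polynomials with \<open>\<int>\<close>, where \<open>i\<close> acts on the
  first copy by \<open>T i\<close> and on the second by \<open>T (- i)\<close>. A homomorphism into this group is a
  homomorphism to \<open>\<int>\<close> together with a crossed homomorphism into each of the two modules, which is
  how the universal property of the free group yields the Fox derivatives below.
\<close>

definition fox_group :: "(laurent \<times> laurent \<times> int) monoid" where
  "fox_group =
     \<lparr>carrier = UNIV,
      mult = (\<lambda>(p, q, i) (p', q', i'). (p + T i * p', q + T (- i) * q', i + i')),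
      one = (0, 0, 0)\<rparr>"

lemma group_fox_group: "group fox_group"
proof (rule groupI)
  fix x assume "x \<in> carrier fox_group"
  obtain p q i where "x = (p, q, i)" by (cases x)
  then show "\<exists>y\<in>carrier fox_group. y \<otimes>\<^bsub>fox_group\<^esub> x = \<one>\<^bsub>fox_group\<^esub>"
    by (intro bexI[of _ "(- T (- i) * p, - T i * q, - i)"]) (simp_all add: fox_group_def)
qed (auto simp: fox_group_def algebra_simps T_add T_add[of "- _" "- _", simplified])

text \<open>
  The three components \<open>x2_deg\<close>, \<open>fox_D\<close> and \<open>fox_D'\<close> of this homomorphism are the exponent sum of
  \<open>x\<^sub>2\<close>, the Fox derivative with respect to \<open>y\<^sub>1\<close> with coefficients pushed forward along \<open>x2_deg\<close>,
  and the same derivative with the variable inverted.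
\<close>

definition fox :: "(nat + nat) word \<Rightarrow> laurent \<times> laurent \<times> int" where
  "fox = free_lift fox_group (case_sum
     (\<lambda>i. (0, 0, if i = 2 then 1 else 0))
     (\<lambda>j. if j = 1 then (1, 1, 0) else (0, 0, 0)))"

definition fox_D :: "(nat + nat) word \<Rightarrow> laurent" where
  "fox_D w = fst (fox w)"

definition fox_D' :: "(nat + nat) word \<Rightarrow> laurent" where
  "fox_D' w = fst (snd (fox w))"

definition x2_deg :: "(nat + nat) word \<Rightarrow> int" where
  "x2_deg w = snd (snd (fox w))"

lemma fox_group_hom: "group_hom (F_nk n k) fox_group fox"
  unfolding F_nk_def fox_def
  by (rule free_lift_group_hom[OF group_fox_group]) (simp add: fox_group_def)

lemma fox_gen: "fox (gen s) =
    case_sum (\<lambda>i. (0, 0, if i = 2 then 1 else 0)) (\<lambda>j. if j = 1 then (1, 1, 0) else (0, 0, 0)) s"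
  unfolding fox_def by (rule free_lift_gen[OF group_fox_group, of _ UNIV]) (auto simp: fox_group_def)

lemma fox_x [simp]:
  "x2_deg (gen (Inl i)) = (if i = 2 then 1 else 0)" "fox_D (gen (Inl i)) = 0" "fox_D' (gen (Inl i)) = 0"
  by (simp_all add: fox_D_def fox_D'_def x2_deg_def fox_gen)

lemma fox_y [simp]:
  "x2_deg (gen (Inr j)) = 0"
  "fox_D (gen (Inr j)) = (if j = 1 then 1 else 0)" "fox_D' (gen (Inr j)) = (if j = 1 then 1 else 0)"
  by (simp_all add: fox_D_def fox_D'_def x2_deg_def fox_gen)

lemma fox_one [simp]: "x2_deg \<one>\<^bsub>F_nk n k\<^esub> = 0" "fox_D \<one>\<^bsub>F_nk n k\<^esub> = 0" "fox_D' \<one>\<^bsub>F_nk n k\<^esub> = 0"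
  using group_hom.hom_one[OF fox_group_hom[of n k]]
  by (simp_all add: fox_D_def fox_D'_def x2_deg_def fox_group_def)

lemma fox_mult:
  assumes "u \<in> carrier (F_nk n k)" "v \<in> carrier (F_nk n k)"
  shows "x2_deg (u \<otimes>\<^bsub>F_nk n k\<^esub> v) = x2_deg u + x2_deg v"
    and "fox_D (u \<otimes>\<^bsub>F_nk n k\<^esub> v) = fox_D u + T (x2_deg u) * fox_D v"
    and "fox_D' (u \<otimes>\<^bsub>F_nk n k\<^esub> v) = fox_D' u + T (- x2_deg u) * fox_D' v"
  using group_hom.hom_mult[OF fox_group_hom assms]
  by (simp_all add: fox_D_def fox_D'_def x2_deg_def fox_group_def split: prod.splits)

lemma fox_inv:
  assumes u: "u \<in> carrier (F_nk n k)"
  shows "x2_deg (inv\<^bsub>F_nk n k\<^esub> u) = - x2_deg u"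
    and "fox_D (inv\<^bsub>F_nk n k\<^esub> u) = - (T (- x2_deg u) * fox_D u)"
    and "fox_D' (inv\<^bsub>F_nk n k\<^esub> u) = - (T (x2_deg u) * fox_D' u)"
proof -
  interpret F: group "F_nk n k" by (rule group_F_nk)
  have *: "inv\<^bsub>F_nk n k\<^esub> u \<in> carrier (F_nk n k)" "inv\<^bsub>F_nk n k\<^esub> u \<otimes>\<^bsub>F_nk n k\<^esub> u = \<one>\<^bsub>F_nk n k\<^esub>"
    using u by auto
  show x2_deg: "x2_deg (inv\<^bsub>F_nk n k\<^esub> u) = - x2_deg u"
    using fox_mult(1)[OF *(1) u] unfolding *(2) by simp
  show "fox_D (inv\<^bsub>F_nk n k\<^esub> u) = - (T (- x2_deg u) * fox_D u)" "fox_D' (inv\<^bsub>F_nk n k\<^esub> u) = - (T (x2_deg u) * fox_D' u)"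
    using fox_mult(2,3)[OF *(1) u] unfolding *(2) x2_deg by (simp_all add: eq_neg_iff_add_eq_0)
qed

text \<open>
  The rule that turns conjugation into multiplication by a power of the variable: the terms with
  the derivative of \<open>g\<close> cancel because \<open>u\<close> has degree zero.
\<close>

lemma fox_conj:
  assumes "g \<in> carrier (F_nk n k)" "u \<in> carrier (F_nk n k)" "x2_deg u = 0"
  shows "x2_deg (g \<otimes>\<^bsub>F_nk n k\<^esub> u \<otimes>\<^bsub>F_nk n k\<^esub> inv\<^bsub>F_nk n k\<^esub> g) = 0"
    and "fox_D (g \<otimes>\<^bsub>F_nk n k\<^esub> u \<otimes>\<^bsub>F_nk n k\<^esub> inv\<^bsub>F_nk n k\<^esub> g) = T (x2_deg g) * fox_D u"
    and "fox_D' (g \<otimes>\<^bsub>F_nk n k\<^esub> u \<otimes>\<^bsub>F_nk n k\<^esub> inv\<^bsub>F_nk n k\<^esub> g) = T (- x2_deg g) * fox_D' u"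
proof -
  interpret F: group "F_nk n k" by (rule group_F_nk)
  show "x2_deg (g \<otimes>\<^bsub>F_nk n k\<^esub> u \<otimes>\<^bsub>F_nk n k\<^esub> inv\<^bsub>F_nk n k\<^esub> g) = 0"
    "fox_D (g \<otimes>\<^bsub>F_nk n k\<^esub> u \<otimes>\<^bsub>F_nk n k\<^esub> inv\<^bsub>F_nk n k\<^esub> g) = T (x2_deg g) * fox_D u"
    "fox_D' (g \<otimes>\<^bsub>F_nk n k\<^esub> u \<otimes>\<^bsub>F_nk n k\<^esub> inv\<^bsub>F_nk n k\<^esub> g) = T (- x2_deg g) * fox_D' u"
    using assms by (simp_all add: fox_mult fox_inv)
qed

abbreviation ker_proj :: "nat \<Rightarrow> nat \<Rightarrow> (nat + nat) word set" where
  "ker_proj n k \<equiv> kernel (F_nk n k) (F_n n) (proj_F n)"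

text \<open>
  The kernel of the projection to \<open>F\<^sub>n\<close> is the normal closure of the \<open>y\<^sub>j\<close>.
\<close>

lemma ker_proj_induct [consumes 1, case_names gen one mult inv conj]:
  assumes w: "w \<in> ker_proj n k"
    and gen: "\<And>j. j \<in> {1..k} \<Longrightarrow> P (gen (Inr j))"
    and one: "P \<one>\<^bsub>F_nk n k\<^esub>"
    and mult: "\<And>u v. u \<in> ker_proj n k \<Longrightarrow> v \<in> ker_proj n k \<Longrightarrow> P u \<Longrightarrow> P v \<Longrightarrow>
      P (u \<otimes>\<^bsub>F_nk n k\<^esub> v)"
    and inv: "\<And>u. u \<in> ker_proj n k \<Longrightarrow> P u \<Longrightarrow> P (inv\<^bsub>F_nk n k\<^esub> u)"
    and conj: "\<And>g u. g \<in> carrier (F_nk n k) \<Longrightarrow> u \<in> ker_proj n k \<Longrightarrow> P u \<Longrightarrow>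
      P (g \<otimes>\<^bsub>F_nk n k\<^esub> u \<otimes>\<^bsub>F_nk n k\<^esub> inv\<^bsub>F_nk n k\<^esub> g)"
  shows "P w"
proof -
  let ?F = "F_nk n k"
  let ?M = "{u \<in> ker_proj n k. P u}"
  interpret p: group_hom ?F "F_n n" "proj_F n" by (rule proj_F_group_hom)
  interpret N: normal "ker_proj n k" ?F by (rule p.normal_kernel)
  have "subgroup ?M ?F"
  proof (rule p.G.subgroupI)
    show "?M \<noteq> {}"
      using one N.one_closed by blast
  qed (use N.subset in \<open>auto intro: mult inv\<close>)
  then have "?M \<lhd> ?F"
    by (auto simp: p.G.normal_inv_iff N.inv_op_closed2 conj)
  moreover have "(\<lambda>j. gen (Inr j)) ` {1..k} \<subseteq> ?M"
    using gen by (auto simp: kernel_def proj_F_gen F_nk_def)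
  ultimately have "normal_closure ?F ((\<lambda>j. gen (Inr j)) ` {1..k}) \<subseteq> ?M"
    unfolding normal_closure_def by (intro hull_minimal)
  then show ?thesis
    using w by (auto simp: kernel_proj_F)
qed

lemma x2_deg_ker_proj: "w \<in> ker_proj n k \<Longrightarrow> x2_deg w = 0"
  by (induction w rule: ker_proj_induct) (auto simp: kernel_def fox_mult fox_inv fox_conj)


section \<open>The crossed homomorphisms\<close>

lemma KIA_nkD:
  assumes f: "f \<in> carrier (KIA_nk n k)"
  shows KIA_nk_auto: "f \<in> auto (F_nk n k)"
    and KIA_nk_conj: "j \<in> {1..k} \<Longrightarrow> \<exists>g\<in>carrier (F_nk n k).
      f (gen (Inr j)) = g \<otimes>\<^bsub>F_nk n k\<^esub> gen (Inr j) \<otimes>\<^bsub>F_nk n k\<^esub> inv\<^bsub>F_nk n k\<^esub> g"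
    and KIA_nk_proj: "w \<in> carrier (F_nk n k) \<Longrightarrow> proj_F n (f w) = proj_F n w"
proof -
  interpret p: group_hom "F_nk n k" "F_n n" "proj_F n" by (rule proj_F_group_hom)
  have fA: "f \<in> carrier (A_nk n k)" and pi: "pi_nk n k f = (\<lambda>x\<in>carrier (F_n n). x)"
    using f by (auto simp: KIA_nk_def K_nk_def kernel_def one_AutoGroup)
  then show fF: "f \<in> auto (F_nk n k)"
    by (simp add: A_nk_def carrier_AutoGroup)
  show "proj_F n (f w) = proj_F n w" if "w \<in> carrier (F_nk n k)"
    using pi_nk_proj_F[OF fA that] that by (simp add: pi)
  assume j: "j \<in> {1..k}"
  then have y: "gen (Inr j) \<in> carrier (F_nk n k)"
    by (auto simp: F_nk_def)
  have "f (gen (Inr j)) \<in> conj_class (F_nk n k) (f (gen (Inr j)))"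
    unfolding conj_class_def using auto_closed[OF fF y]
    by (intro CollectI exI[of _ "\<one>\<^bsub>F_nk n k\<^esub>"]) simp
  also have "\<dots> = conj_class (F_nk n k) (gen (Inr j))"
    using fA j by (simp add: A_nk_def)
  finally show "\<exists>g\<in>carrier (F_nk n k).
      f (gen (Inr j)) = g \<otimes>\<^bsub>F_nk n k\<^esub> gen (Inr j) \<otimes>\<^bsub>F_nk n k\<^esub> inv\<^bsub>F_nk n k\<^esub> g"
    by (auto simp: conj_class_def)
qed

lemma KIA_nkI:
  assumes f: "f \<in> auto (F_nk n k)"
    and y: "\<And>j. j \<in> {1..k} \<Longrightarrow> f (gen (Inr j)) = gen (Inr j)"
    and proj: "\<And>w. w \<in> carrier (F_nk n k) \<Longrightarrow> proj_F n (f w) = proj_F n w"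
    and ab: "\<And>w. w \<in> carrier (F_nk n k) \<Longrightarrow>
      derived (F_nk n k) (carrier (F_nk n k)) #>\<^bsub>F_nk n k\<^esub> f w =
      derived (F_nk n k) (carrier (F_nk n k)) #>\<^bsub>F_nk n k\<^esub> w"
  shows "f \<in> carrier (KIA_nk n k)"
proof -
  interpret F: group "F_nk n k" by (rule group_F_nk)
  interpret s: group_hom "F_n n" "F_nk n k" "incl_F n k" by (rule incl_F_group_hom)
  have fA: "f \<in> carrier (A_nk n k)"
    using f y by (simp add: A_nk_def carrier_AutoGroup)
  have "pi_nk n k f = (\<lambda>x\<in>carrier (F_n n). x)"
  proof (rule extensionalityI)
    show "pi_nk n k f \<in> extensional (carrier (F_n n))"
      using pi_nk_hom[of n k] fA by (auto simp: hom_def carrier_AutoGroup auto_iff)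
    fix v assume v: "v \<in> carrier (F_n n)"
    then show "pi_nk n k f v = (\<lambda>x\<in>carrier (F_n n). x) v"
      using pi_nk_proj_F[OF fA s.hom_closed[OF v]] proj[OF s.hom_closed[OF v]]
      by (simp add: proj_incl_F)
  qed simp
  moreover have "ab_action (F_nk n k) f = (\<lambda>x\<in>carrier (abelianization (F_nk n k)). x)"
  proof (rule extensionalityI)
    show "ab_action (F_nk n k) f \<in> extensional (carrier (abelianization (F_nk n k)))"
      by (simp add: ab_action_def)
    fix C assume "C \<in> carrier (abelianization (F_nk n k))"
    then show "ab_action (F_nk n k) f C = (\<lambda>x\<in>carrier (abelianization (F_nk n k)). x) C"
      by (auto simp: F.carrier_abelianization F.ab_action_coset f ab)
  qed simp
  ultimately show ?thesis
    using f fA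
    by (simp add: KIA_nk_def K_nk_def IA_nk_def kernel_def one_AutoGroup carrier_AutoGroup)
qed

text \<open>
  An element \<open>f\<close> of the group conjugates \<open>y\<^sub>1\<close> by a word, which is unique up to right multiplication
  by powers of \<open>y\<^sub>1\<close>; the degree in \<open>x\<^sub>2\<close> is therefore independent of the choice.
\<close>

definition twist :: "nat \<Rightarrow> nat \<Rightarrow> ((nat + nat) word \<Rightarrow> (nat + nat) word) \<Rightarrow> int" where
  "twist n k f = x2_deg (SOME g. g \<in> carrier (F_nk n k) \<and>
     f (gen (Inr 1)) = g \<otimes>\<^bsub>F_nk n k\<^esub> gen (Inr 1) \<otimes>\<^bsub>F_nk n k\<^esub> inv\<^bsub>F_nk n k\<^esub> g)"

text \<open>
  The cup square of the crossed homomorphism \<open>f \<mapsto> fox_D (f x\<^sub>1)\<close> with respect to the invariant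
  sesquilinear pairing that sends \<open>p\<close> and \<open>q\<close> to the product of \<open>q\<close> with the image of \<open>p\<close> under
  inversion of the variable. Inverting the variable in \<open>fox_D (f x\<^sub>1)\<close> gives \<open>fox_D' (f x\<^sub>1)\<close>.
\<close>

definition fox_cocycle ::
    "nat \<Rightarrow> nat \<Rightarrow> ((nat + nat) word \<Rightarrow> (nat + nat) word) \<Rightarrow> ((nat + nat) word \<Rightarrow> (nat + nat) word) \<Rightarrow> laurent"
  where "fox_cocycle n k f g = fox_D' (f (gen (Inl 1))) * T (twist n k f) * fox_D (g (gen (Inl 1)))"

context
  fixes n k :: nat
  assumes n: "n \<ge> 2" and k: "k \<ge> 1"
  \<comment> \<open>Keeps \<open>x\<^sub>1\<close> and \<open>y\<^sub>1\<close> in the form in which they are abbreviated.\<close>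
  notes One_nat_def [simp del]
begin

private abbreviation "F \<equiv> F_nk n k"
private abbreviation "K \<equiv> KIA_nk n k"
private abbreviation "x\<^sub>1 \<equiv> gen (Inl 1) :: (nat + nat) word"
private abbreviation "x\<^sub>2 \<equiv> gen (Inl 2) :: (nat + nat) word"
private abbreviation "y\<^sub>1 \<equiv> gen (Inr 1) :: (nat + nat) word"

interpretation F: group "F_nk n k"
  by (rule group_F_nk)

interpretation p: group_hom "F_nk n k" "F_n n" "proj_F n"
  by (rule proj_F_group_hom)

interpretation K: group "KIA_nk n k"
  by (rule group_KIA_nk)

lemma gens_closed: "x\<^sub>1 \<in> carrier F" "x\<^sub>2 \<in> carrier F" "y\<^sub>1 \<in> carrier F"
  using n k by (auto simp: F_nk_def)

lemma KIA_nk_group_hom: "f \<in> carrier K \<Longrightarrow> group_hom F F f"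
  by (rule F.auto_group_hom[OF KIA_nk_auto])

lemma KIA_nk_mult: "f \<in> carrier K \<Longrightarrow> g \<in> carrier K \<Longrightarrow> f \<otimes>\<^bsub>K\<^esub> g = compose (carrier F) f g"
  using mult_AutoGroup[OF KIA_nk_auto KIA_nk_auto] by (simp add: KIA_nk_def)

lemma KIA_nk_ker_proj:
  assumes f: "f \<in> carrier K" and w: "w \<in> carrier F"
  shows "inv\<^bsub>F\<^esub> w \<otimes>\<^bsub>F\<^esub> f w \<in> ker_proj n k"
  using auto_closed[OF KIA_nk_auto[OF f] w] w by (simp add: kernel_def KIA_nk_proj[OF f])

lemma x2_deg_KIA_nk:
  assumes f: "f \<in> carrier K" and w: "w \<in> carrier F"
  shows "x2_deg (f w) = x2_deg w"
  using x2_deg_ker_proj[OF KIA_nk_ker_proj[OF f w]] auto_closed[OF KIA_nk_auto[OF f] w] w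
  by (simp add: fox_mult fox_inv)

lemma fox_KIA_nk_y\<^sub>1:
  assumes f: "f \<in> carrier K"
  shows "fox_D (f y\<^sub>1) = T (twist n k f)" "fox_D' (f y\<^sub>1) = T (- twist n k f)"
proof -
  let ?P = "\<lambda>g. g \<in> carrier F \<and> f y\<^sub>1 = g \<otimes>\<^bsub>F\<^esub> y\<^sub>1 \<otimes>\<^bsub>F\<^esub> inv\<^bsub>F\<^esub> g"
  have "\<exists>g. ?P g"
    using KIA_nk_conj[OF f, of 1] k by auto
  then have "?P (SOME g. ?P g)"
    by (rule someI_ex)
  then obtain g where "?P g" "twist n k f = x2_deg g"
    by (auto simp: twist_def)
  then show "fox_D (f y\<^sub>1) = T (twist n k f)" "fox_D' (f y\<^sub>1) = T (- twist n k f)"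
    using gens_closed by (simp_all add: fox_conj)
qed

text \<open>
  On the kernel of the projection the derivative is a homomorphism, and conjugation by a word \<open>g\<close>
  multiplies it by \<open>T (x2_deg g)\<close>. Since \<open>f\<close> preserves \<open>x2_deg\<close>, composing with \<open>f\<close> does not affect
  this equivariance, so the claim only has to be checked on the \<open>y\<^sub>j\<close>. There \<open>f\<close> acts by conjugation,
  and only \<open>y\<^sub>1\<close> has a non-zero derivative.
\<close>

lemma fox_KIA_nk_ker_proj:
  assumes f: "f \<in> carrier K" and w: "w \<in> ker_proj n k"
  shows "fox_D (f w) = T (twist n k f) * fox_D w" "fox_D' (f w) = T (- twist n k f) * fox_D' w"
proof -
  interpret f: group_hom F F f by (rule KIA_nk_group_hom[OF f])
  have "fox_D (f w) = T (twist n k f) * fox_D w \<and> fox_D' (f w) = T (- twist n k f) * fox_D' w"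
    using w
  proof (induction w rule: ker_proj_induct)
    case (gen j)
    show ?case
    proof (cases "j = 1")
      case True
      then show ?thesis by (simp add: fox_KIA_nk_y\<^sub>1[OF f])
    next
      case False
      obtain g where "g \<in> carrier F" "f (gen (Inr j)) = g \<otimes>\<^bsub>F\<^esub> gen (Inr j) \<otimes>\<^bsub>F\<^esub> inv\<^bsub>F\<^esub> g"
        using KIA_nk_conj[OF f gen] by blast
      moreover have "gen (Inr j) \<in> carrier F"
        using gen by (auto simp: F_nk_def)
      ultimately show ?thesis
        using False by (simp add: fox_conj)
    qed
  next
    case one
    then show ?case by simp
  next
    case (mult u v)
    then have "u \<in> carrier F" "v \<in> carrier F" "x2_deg u = 0"
      by (auto simp: kernel_def x2_deg_ker_proj)
    then show ?case
      using mult by (simp add: fox_mult x2_deg_KIA_nk[OF f] algebra_simps)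
  next
    case (inv u)
    then have "u \<in> carrier F" "x2_deg u = 0"
      by (auto simp: kernel_def x2_deg_ker_proj)
    then show ?case
      using inv by (simp add: fox_inv x2_deg_KIA_nk[OF f])
  next
    case (conj g u)
    then have "u \<in> carrier F" "x2_deg u = 0"
      by (auto simp: kernel_def x2_deg_ker_proj)
    then show ?case
      using conj by (simp add: fox_conj x2_deg_KIA_nk[OF f] algebra_simps)
  qed
  then show "fox_D (f w) = T (twist n k f) * fox_D w" "fox_D' (f w) = T (- twist n k f) * fox_D' w"
    by auto
qed

text \<open>
  Write \<open>g x\<^sub>1 = x\<^sub>1 v\<close> with \<open>v\<close> in the kernel of the projection. As \<open>x\<^sub>1\<close> has degree zero, the product
  rule gives \<open>fox_D (f (g x\<^sub>1)) = fox_D (f x\<^sub>1) + fox_D (f v)\<close>, and \<open>f\<close> multiplies the derivative of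
  \<open>v\<close> by \<open>T (twist n k f)\<close>. The same multiplication rule, applied to \<open>g y\<^sub>1\<close>, makes \<open>twist\<close> additive.
\<close>

lemma crossed_hom:
  assumes f: "f \<in> carrier K" and g: "g \<in> carrier K"
  shows "twist n k (f \<otimes>\<^bsub>K\<^esub> g) = twist n k f + twist n k g"
    and "fox_D ((f \<otimes>\<^bsub>K\<^esub> g) x\<^sub>1) = fox_D (f x\<^sub>1) + T (twist n k f) * fox_D (g x\<^sub>1)"
    and "fox_D' ((f \<otimes>\<^bsub>K\<^esub> g) x\<^sub>1) = fox_D' (f x\<^sub>1) + T (- twist n k f) * fox_D' (g x\<^sub>1)"
proof -
  interpret f: group_hom F F f by (rule KIA_nk_group_hom[OF f])
  interpret g: group_hom F F g by (rule KIA_nk_group_hom[OF g])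
  have "y\<^sub>1 \<in> ker_proj n k"
    using gens_closed by (simp add: kernel_def proj_F_gen)
  then have "g y\<^sub>1 \<in> ker_proj n k"
    using gens_closed by (simp add: kernel_def KIA_nk_proj[OF g])
  then have "fox_D (f (g y\<^sub>1)) = T (twist n k f) * T (twist n k g)"
    by (simp add: fox_KIA_nk_ker_proj[OF f] fox_KIA_nk_y\<^sub>1[OF g])
  then have "T (twist n k (f \<otimes>\<^bsub>K\<^esub> g)) = T (twist n k f + twist n k g)"
    using fox_KIA_nk_y\<^sub>1(1)[OF K.m_closed[OF f g]] f g gens_closed
    by (simp add: KIA_nk_mult compose_eq T_add)
  then show "twist n k (f \<otimes>\<^bsub>K\<^esub> g) = twist n k f + twist n k g"
    by simp
  define v where "v = inv\<^bsub>F\<^esub> x\<^sub>1 \<otimes>\<^bsub>F\<^esub> g x\<^sub>1"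
  have v: "v \<in> ker_proj n k" "v \<in> carrier F"
    using KIA_nk_ker_proj[OF g gens_closed(1)] by (auto simp: v_def kernel_def)
  have "g x\<^sub>1 = x\<^sub>1 \<otimes>\<^bsub>F\<^esub> v"
    using gens_closed by (simp add: v_def flip: F.m_assoc)
  then show "fox_D ((f \<otimes>\<^bsub>K\<^esub> g) x\<^sub>1) = fox_D (f x\<^sub>1) + T (twist n k f) * fox_D (g x\<^sub>1)"
    "fox_D' ((f \<otimes>\<^bsub>K\<^esub> g) x\<^sub>1) = fox_D' (f x\<^sub>1) + T (- twist n k f) * fox_D' (g x\<^sub>1)"
    using f g v gens_closed
    by (simp_all add: KIA_nk_mult compose_eq fox_mult x2_deg_KIA_nk[OF f] fox_KIA_nk_ker_proj[OF f])
qed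

private abbreviation "F' \<equiv> free_group ({1..n} <+> {1..k} - {Inl 1 :: nat + nat})"

lemma transvection_in_KIA_nk:
  assumes u: "u \<in> carrier F'" "proj_F n u = \<one>\<^bsub>F_n n\<^esub>" "u \<in> derived F (carrier F)"
    and v: "v \<in> carrier F'" "proj_F n v = \<one>\<^bsub>F_n n\<^esub>" "v \<in> derived F (carrier F)"
  shows "transvection ({1..n} <+> {1..k}) (Inl 1) u v \<in> carrier K"
proof -
  let ?S = "{1..n} <+> {1..k}" and ?C = "derived F (carrier F)"
  have 1: "Inl 1 \<in> ?S"
    using n by auto
  interpret C: normal ?C F by (rule F.derived_self_is_normal)
  show ?thesis
  proof (rule KIA_nkI)
    show "transvection ?S (Inl 1) u v \<in> auto F"
      using transvection_auto[OF 1 u(1) v(1)] by (simp add: F_nk_def)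
    show "transvection ?S (Inl 1) u v (gen (Inr j)) = gen (Inr j)" if "j \<in> {1..k}" for j
      using that by (intro transvection_gen_other[OF 1 u(1) v(1)]) auto
    fix w assume w: "w \<in> carrier F"
    show "proj_F n (transvection ?S (Inl 1) u v w) = proj_F n w"
      using hom_transvection_eq[OF 1 group_F_n, of "proj_F n"] p.homh u v w by (simp add: F_nk_def)
    have hom: "(\<lambda>w. ?C #>\<^bsub>F\<^esub> w) \<in> hom (free_group ?S) (F Mod ?C)"
      using C.r_coset_hom_Mod by (simp add: F_nk_def)
    show "?C #>\<^bsub>F\<^esub> transvection ?S (Inl 1) u v w = ?C #>\<^bsub>F\<^esub> w"
      using hom_transvection_eq[OF 1 C.factorgroup_is_group hom u(1) _ v(1)] u(3) v(3) w
        C.rcos_const[OF F.is_group] by (simp add: F_nk_def)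
  qed
qed


text \<open>
  The crossed homomorphism \<open>fox_D'\<close> transforms by \<open>T (- twist n k f)\<close>, which cancels against the
  factor \<open>T (twist n k f)\<close> of the cocycle.
\<close>

lemma KIA_nk_two_cocycle:
  "two_cocycle K (fox_cocycle n k)"
  by (auto simp: two_cocycle_def fox_cocycle_def crossed_hom T_add algebra_simps)

text \<open>
  The commutator of \<open>x\<^sub>2\<close> to the power \<open>m\<close> with \<open>y\<^sub>1\<close>, formed in the free group without \<open>x\<^sub>1\<close> so that it
  can be used in a transvection of \<open>x\<^sub>1\<close>.
\<close>

definition comm_word :: "nat \<Rightarrow> (nat + nat) word" where
  "comm_word m = x\<^sub>2 [^]\<^bsub>F'\<^esub> m \<otimes>\<^bsub>F'\<^esub> y\<^sub>1 \<otimes>\<^bsub>F'\<^esub> inv\<^bsub>F'\<^esub> (x\<^sub>2 [^]\<^bsub>F'\<^esub> m) \<otimes>\<^bsub>F'\<^esub> inv\<^bsub>F'\<^esub> y\<^sub>1"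

lemma
  shows comm_word_closed: "comm_word m \<in> carrier F'"
    and comm_word_eq: "comm_word m =
      x\<^sub>2 [^]\<^bsub>F\<^esub> m \<otimes>\<^bsub>F\<^esub> y\<^sub>1 \<otimes>\<^bsub>F\<^esub> inv\<^bsub>F\<^esub> (x\<^sub>2 [^]\<^bsub>F\<^esub> m) \<otimes>\<^bsub>F\<^esub> inv\<^bsub>F\<^esub> y\<^sub>1"
proof -
  interpret F': group F' by (rule group_free_group)
  have gens: "x\<^sub>2 \<in> carrier F'" "y\<^sub>1 \<in> carrier F'"
    using n k by auto
  show "comm_word m \<in> carrier F'"
    using gens by (simp add: comm_word_def)
  interpret \<iota>: group_hom F' F "\<lambda>w. w"
    using id_hom_free_group[of "{1..n} <+> {1..k} - {Inl 1}" "{1..n} <+> {1..k}"]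
    by (auto simp: group_hom_def group_hom_axioms_def group_free_group F_nk_def)
  have "x\<^sub>2 [^]\<^bsub>F'\<^esub> m = x\<^sub>2 [^]\<^bsub>F\<^esub> m"
    using \<iota>.hom_nat_pow[OF gens(1)] .
  then show "comm_word m =
      x\<^sub>2 [^]\<^bsub>F\<^esub> m \<otimes>\<^bsub>F\<^esub> y\<^sub>1 \<otimes>\<^bsub>F\<^esub> inv\<^bsub>F\<^esub> (x\<^sub>2 [^]\<^bsub>F\<^esub> m) \<otimes>\<^bsub>F\<^esub> inv\<^bsub>F\<^esub> y\<^sub>1"
    using gens gens_closed F'.nat_pow_closed[OF gens(1), of m]
    by (simp add: comm_word_def free_group_simps F_nk_def del: F'.nat_pow_closed)
qed

lemma fox_comm_word: "x2_deg (comm_word m) = 0" "fox_D (comm_word m) = T (int m) - 1"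
  "fox_D' (comm_word m) = T (- int m) - 1"
proof -
  have "x2_deg (x\<^sub>2 [^]\<^bsub>F\<^esub> m) = int m \<and> fox_D (x\<^sub>2 [^]\<^bsub>F\<^esub> m) = 0 \<and> fox_D' (x\<^sub>2 [^]\<^bsub>F\<^esub> m) = 0"
    by (induction m) (use gens_closed in \<open>simp_all add: fox_mult\<close>)
  then show "x2_deg (comm_word m) = 0" "fox_D (comm_word m) = T (int m) - 1"
    "fox_D' (comm_word m) = T (- int m) - 1"
    using gens_closed by (simp_all add: comm_word_eq fox_mult fox_inv)
qed

lemma comm_word_ker_proj: "proj_F n (comm_word m) = \<one>\<^bsub>F_n n\<^esub>"
  using gens_closed by (simp add: comm_word_eq proj_F_gen(2))

lemma comm_word_derived: "comm_word m \<in> derived F (carrier F)"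
  unfolding comm_word_eq derived_def
  using gens_closed by (intro generate.incl) auto

text \<open>
  The transvections \<open>f: x\<^sub>1 \<mapsto> [x\<^sub>2, y\<^sub>1] x\<^sub>1\<close> and \<open>g: x\<^sub>1 \<mapsto> x\<^sub>1 [x\<^sub>2\<^sup>m, y\<^sub>1]\<close> commute because they multiply
  on different sides. With \<open>t = T 1\<close> they have derivatives \<open>t - 1\<close> and \<open>t\<^sup>m - 1\<close>, so that the two
  values of the cocycle are \<open>(1/t - 1) (t\<^sup>m - 1)\<close> and \<open>(1/t\<^sup>m - 1) (t - 1)\<close>. For \<open>m \<ge> 2\<close> the monomial
  \<open>t\<^sup>m\<close> occurs in the first of them only.
\<close>

lemma KIA_nk_commuting_pair:
  fixes m :: nat
  assumes m: "m \<ge> 2"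
  obtains f g where "f \<in> carrier K" "g \<in> carrier K" "f \<otimes>\<^bsub>K\<^esub> g = g \<otimes>\<^bsub>K\<^esub> f"
    "int m \<in> Poly_Mapping.keys (fox_cocycle n k f g - fox_cocycle n k g f)"
proof -
  let ?S = "{1..n} <+> {1..k}"
  let ?\<tau> = "transvection ?S (Inl 1)"
  have F: "free_group ?S = F"
    by (simp add: F_nk_def)
  have 1: "Inl 1 \<in> ?S"
    using n by auto
  have one: "\<one>\<^bsub>F\<^esub> \<in> carrier F'"
    using monoid.one_closed[OF group.is_monoid[OF group_free_group[of "?S - {Inl 1}"]]]
    by (simp add: free_group_simps F_nk_def)
  have one': "\<one>\<^bsub>F\<^esub> \<in> derived F (carrier F)"
    by (simp add: derived_def generate.one)
  note cw = comm_word_closed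
  have cwF: "comm_word i \<in> carrier F" for i
    using free_group_remove_closed[OF 1 cw] by (simp add: F)
  define f where "f = ?\<tau> (comm_word 1) \<one>\<^bsub>F\<^esub>"
  define g where "g = ?\<tau> \<one>\<^bsub>F\<^esub> (comm_word m)"
  have f: "f \<in> carrier K" and g: "g \<in> carrier K"
    unfolding f_def g_def
    by (intro transvection_in_KIA_nk cw comm_word_ker_proj comm_word_derived one one' p.hom_one)+
  have "f (g w) = g (f w)" if w: "w \<in> carrier F" for w
    using transvection_transvection[OF 1 cw one one cw, of w 1 m] cwF
      transvection_transvection[OF 1 one cw cw one, of w m 1] w
    by (simp add: f_def g_def F)
  then have comm: "f \<otimes>\<^bsub>K\<^esub> g = g \<otimes>\<^bsub>K\<^esub> f"
    using f g by (auto simp: KIA_nk_mult compose_def)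
  have "f x\<^sub>1 = comm_word 1 \<otimes>\<^bsub>F\<^esub> x\<^sub>1" "g x\<^sub>1 = x\<^sub>1 \<otimes>\<^bsub>F\<^esub> comm_word m"
    using transvection_gen[OF 1 cw one, of 1] transvection_gen[OF 1 one cw, of m] cwF gens_closed
    by (simp_all add: f_def g_def F)
  then have fox: "fox_D (f x\<^sub>1) = T 1 - 1" "fox_D' (f x\<^sub>1) = T (- 1) - 1"
    "fox_D (g x\<^sub>1) = T (int m) - 1" "fox_D' (g x\<^sub>1) = T (- int m) - 1"
    using cwF gens_closed by (simp_all add: fox_mult fox_comm_word)
  have "Inr 1 \<in> ?S"
    using k by auto
  then have "f y\<^sub>1 = y\<^sub>1" "g y\<^sub>1 = y\<^sub>1"
    using transvection_gen_other[OF 1 cw one] transvection_gen_other[OF 1 one cw]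
    by (simp_all add: f_def g_def)
  then have "T (twist n k f) = T 0" "T (twist n k g) = T 0"
    using fox_KIA_nk_y\<^sub>1(1)[OF f] fox_KIA_nk_y\<^sub>1(1)[OF g] by simp_all
  then have "fox_cocycle n k f g - fox_cocycle n k g f =
      (T (- 1 + int m) - T (- 1) - T (int m)) - (T (- int m + 1) - T (- int m) - T 1)"
    by (simp only: fox_cocycle_def fox T_add T_0) (simp add: algebra_simps)
  then have "Poly_Mapping.lookup (fox_cocycle n k f g - fox_cocycle n k g f) (int m) = - 1"
    using m by (simp add: lookup_minus lookup_T)
  then show thesis
    using that[OF f g comm] by (simp add: in_keys_iff)
qed

lemma KIA_nk_cocycle_not_finitely_supported:
  assumes J: "finite J" "\<And>f g. f \<in> carrier K \<Longrightarrow> g \<in> carrier K \<Longrightarrow> f \<otimes>\<^bsub>K\<^esub> g = g \<otimes>\<^bsub>K\<^esub> f \<Longrightarrow>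
    Poly_Mapping.keys (fox_cocycle n k f g - fox_cocycle n k g f) \<subseteq> J"
  shows False
proof -
  have "int ` {2..} \<subseteq> J"
  proof safe
    fix m :: nat assume "m \<ge> 2"
    then obtain f g where "f \<in> carrier K" "g \<in> carrier K" "f \<otimes>\<^bsub>K\<^esub> g = g \<otimes>\<^bsub>K\<^esub> f"
      "int m \<in> Poly_Mapping.keys (fox_cocycle n k f g - fox_cocycle n k g f)"
      by (rule KIA_nk_commuting_pair)
    then show "int m \<in> J"
      using J(2) by blast
  qed
  then have "finite (int ` {2..})"
    using J(1) by (rule finite_subset)
  then have "finite {2::nat..}"
    by (rule finite_imageD) simp
  then show False
    by (simp add: infinite_Ici)
qed

end


section \<open>Infinite second homology\<close>

theorem theorem2:
  fixes n k :: nat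
  assumes "n \<ge> 2" and "k \<ge> 1"
  shows "\<not> vectorspace.fin_dim class_ring (group_homology (KIA_nk n k) 2)
    \<and> \<not> finitely_presentable (KIA_nk n k)"
proof (intro conjI notI)
  note cocycle = KIA_nk_two_cocycle[OF assms]
    and unbounded = KIA_nk_cocycle_not_finitely_supported[OF assms]
  show False if fin: "vectorspace.fin_dim class_ring (group_homology (KIA_nk n k) 2)"
    by (rule group.commuting_support_finite_if_H2_fin_dim[OF group_KIA_nk cocycle fin])
      (rule unbounded)
  show False if fp: "finitely_presentable (KIA_nk n k)"
    by (rule group.commuting_support_finite_if_finitely_presentable[OF group_KIA_nk cocycle fp])
      (rule unbounded)
qed

end
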